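(* Let $n \in \mathbb{Z}_{>1}$. Then $$q^{\lceil (n/2)(i-1)\rceil} \mid M_i(f,u)$$ for all rigid $K$-analytic functions $f$ on $R^n$ defined over $R$, all $i \in \mathbb{Z}_{>0}$ and all $u \in R/P^i$.
   Context: $K$ is a $p$-adic field, i.e., an extension of $\mathbb{Q}_p$ of finite degree; $R$ is its valuation ring, $P$ the maximal ideal of $R$, and $q$ the cardinality of the residue field $R/P$. A rigid $K$-analytic function on $R^n$ is a function given by a power series $f=\sum_{(i_1,\ldots,i_n)\in\mathbb{Z}_{\geq 0}^n} c_{i_1,\ldots,i_n}x_1^{i_1}\cdots x_n^{i_n}$ over $K$ that converges at every point of $R^n$ (equivalently, $|c_{i_1,\ldots,i_n}|\to 0$ as $i_1+\cdots+i_n\to\infty$); it is defined over $R$ if all coefficients $c_{i_1,\ldots,i_n}$ lie in $R$. For such $f$ defined over $R$, $i\in\mathbb{Z}_{\geq 0}$ and $u\in R/P^i$, $M_i(f,u)$ denotes the number of solutions of $f(x)\equiv u \bmod P^i$ in $(R/P^i)^n$ (the value of $f(x)$ modulo $P^i$ depends only on $x$ modulo $P^i$). $\lceil y\rceil$ denotes the smallest integer larger than or equal to $y$. *)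

theory Defs
  imports "HOL-Analysis.Analysis" "HOL-Computational_Algebra.Primes"
begin

definition padic_abs :: "nat \<Rightarrow> rat \<Rightarrow> real" where
  "padic_abs p r = (if r = 0 then 0 else
     (let (a, b) = quotient_of r in
       real p powi (int (multiplicity (int p) b) - int (multiplicity (int p) a))))"

class nonarch_valued_field = field_char_0 + metric_space +
  fixes absval :: "'a \<Rightarrow> real"
  assumes dist_absval: "dist x y = absval (x - y)"
    and absval_mult: "absval (x * y) = absval x * absval y"
    and absval_ultrametric: "absval (x + y) \<le> max (absval x) (absval y)"

text \<open>
  A \<open>p\<close>-adic field \<open>K\<close> is a type carrying the absolute value that extends the \<open>p\<close>-adic one of \<open>\<rat>\<close>.
  The closure of \<open>\<rat>\<close> in \<open>K\<close> is required to be complete, so it is the completion of \<open>\<rat>\<close> for the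
  \<open>p\<close>-adic absolute value, i.e. \<open>\<rat>\<^sub>p\<close>; and \<open>K\<close> is spanned by finitely many elements over it.
\<close>

definition padic_numbers :: "'k::nonarch_valued_field set" where
  "padic_numbers = closure \<rat>"

definition padic_field :: "nat \<Rightarrow> 'k::nonarch_valued_field itself \<Rightarrow> bool" where
  "padic_field p _ \<longleftrightarrow>
     prime p \<and>
     (\<forall>r. absval (of_rat r :: 'k) = padic_abs p r) \<and>
     complete (padic_numbers :: 'k set) \<and>
     (\<exists>B :: 'k set. finite B \<and>
        (\<forall>x. \<exists>c. (\<forall>b\<in>B. c b \<in> padic_numbers) \<and> x = (\<Sum>b\<in>B. c b * b)))"

definition valuation_ring :: "'k::nonarch_valued_field set" where
  "valuation_ring = {x. absval x \<le> 1}"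

definition max_ideal :: "'k::nonarch_valued_field set" where
  "max_ideal = {x. absval x < 1}"

definition ideal_mult :: "'k::comm_ring_1 set \<Rightarrow> 'k set \<Rightarrow> 'k set" where
  "ideal_mult I J =
     {(\<Sum>k<m. a k * b k) | (m::nat) a b. (\<forall>k<m. a k \<in> I) \<and> (\<forall>k<m. b k \<in> J)}"

primrec max_ideal_power :: "nat \<Rightarrow> 'k::nonarch_valued_field set" where
  "max_ideal_power 0 = valuation_ring"
| "max_ideal_power (Suc i) = ideal_mult max_ideal (max_ideal_power i)"

definition coset :: "'k::ab_group_add set \<Rightarrow> 'k \<Rightarrow> 'k set" where
  "coset I x = (+) x ` I"

definition quotient_ring :: "'k::nonarch_valued_field set \<Rightarrow> 'k set set" where
  "quotient_ring I = coset I ` valuation_ring"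

definition residue_card :: "'k::nonarch_valued_field itself \<Rightarrow> nat" where
  "residue_card _ = card (quotient_ring (max_ideal :: 'k set))"

definition valuation_ring_power :: "('k::nonarch_valued_field ^ 'n) set" where
  "valuation_ring_power = {x. \<forall>j. x $ j \<in> valuation_ring}"

text \<open>
  Convergence of a power series in several variables is unordered summability for the metric of
  \<open>K\<close>; as the absolute value is non-archimedean and \<open>K\<close> is complete, this amounts to the terms
  tending to \<open>0\<close>. Only the values of \<open>f\<close> on \<open>R\<^sup>n\<close> matter.
\<close>

definition is_power_series_of :: "(nat ^ 'n \<Rightarrow> 'k::nonarch_valued_field) \<Rightarrow> ('k ^ 'n \<Rightarrow> 'k) \<Rightarrow> bool" where
  "is_power_series_of c f \<longleftrightarrow>
     (\<forall>x\<in>valuation_ring_power.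
        ((\<lambda>m. c m * (\<Prod>j\<in>UNIV. (x $ j) ^ (m $ j))) has_sum f x) UNIV)"

definition rigid_analytic_over_R :: "('k::nonarch_valued_field ^ 'n \<Rightarrow> 'k) \<Rightarrow> bool" where
  "rigid_analytic_over_R f \<longleftrightarrow> (\<exists>c. is_power_series_of c f \<and> range c \<subseteq> valuation_ring)"

text \<open>
  Since \<open>f(x) mod P\<^sup>i\<close> depends only on \<open>x mod P\<^sup>i\<close>, a tuple of residue classes is a solution iff
  some (equivalently, every) representative \<open>x\<close> of it satisfies \<open>f(x) \<equiv> u mod P\<^sup>i\<close>.
\<close>

definition num_solutions :: "nat \<Rightarrow> ('k::nonarch_valued_field ^ 'n \<Rightarrow> 'k) \<Rightarrow> 'k set \<Rightarrow> nat" where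
  "num_solutions i f u =
     card {X :: 'k set ^ 'n. \<exists>x\<in>valuation_ring_power.
       X = (\<chi> j. coset (max_ideal_power i) (x $ j)) \<and> coset (max_ideal_power i) (f x) = u}"

end

theory Submission imports Defs begin

text \<open>
  Let \<open>\<pi>\<close> be a uniformizer and \<open>n\<close> the number of variables. Modulo \<open>P\<^sup>i\<close> the function \<open>f\<close> may
  be replaced by a polynomial, since its coefficients tend to \<open>0\<close>
  (\<open>rigid_analytic_approx_poly_fun\<close>). The solutions of \<open>f(x) \<equiv> w mod P\<^sup>i\<close> are then sorted by the
  residue class \<open>a\<close> of \<open>x\<close> modulo \<open>P\<close>; on such a class one has
  \<open>f(a + \<pi> y) = f(a) + \<pi> (d \<bullet> y) + \<pi>\<^sup>2 g(y)\<close>, where \<open>d\<close> is the gradient at \<open>a\<close> and \<open>g\<close> is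
  again a polynomial over \<open>R\<close> (\<open>poly_fun_taylor\<close>), and \<open>y\<close> matters modulo \<open>P\<^sup>i\<^sup>-\<^sup>1\<close>.

  If some \<open>d\<^sub>j\<close> is a unit, the \<open>j\<close>-th coordinate of a solution is determined by the other ones
  as in Hensel's lemma, so the class contains \<open>0\<close> or exactly \<open>q\<^bsup>(n - 1)(i - 1)\<^esup>\<close> solutions
  (\<open>class_count_hensel\<close>), and \<open>n - 1 \<ge> n/2\<close> because \<open>n \<ge> 2\<close>. Otherwise \<open>\<pi>\<close> divides \<open>d\<close>, the
  linear term is absorbed into \<open>g\<close>, and the congruence is either unsolvable on the class or
  amounts to \<open>g(y) \<equiv> w' mod P\<^sup>i\<^sup>-\<^sup>2\<close>. As \<open>y\<close> is counted modulo \<open>P\<^sup>i\<^sup>-\<^sup>1\<close>, the class contributes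
  \<open>q\<^sup>n\<close> times the count for \<open>g\<close> at level \<open>i - 2\<close> (\<open>class_count_Suc_periodic\<close>), and
  \<open>n + (n/2)(i - 3) = (n/2)(i - 1)\<close>: strong induction on \<open>i\<close> concludes
  (\<open>residue_card_power_dvd_class_count\<close>).

  A uniformizer and the finiteness of the residue field come from the finiteness of \<open>R/pR\<close>. The
  \<open>\<rat>\<close>-span of a finite generating set of \<open>K\<close> over \<open>\<rat>\<^sub>p\<close> is dense in \<open>K\<close>, so classes modulo \<open>p\<close>
  have representatives in a finite-dimensional rational vector space; and elements of \<open>R\<close> that are
  linearly independent modulo \<open>p\<close> are linearly independent over \<open>\<rat>\<close>, which bounds the dimension
  of \<open>R/pR\<close> over the field with \<open>p\<close> elements (\<open>finite_representatives_mod_p\<close>).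
\<close>

section \<open>The absolute value\<close>

lemma absval_eq_dist: "absval (x::'k::nonarch_valued_field) = dist x 0"
  by (simp add: dist_absval)

lemma absval_nonneg [simp]: "0 \<le> absval (x::'k::nonarch_valued_field)"
  by (simp add: absval_eq_dist)

lemma absval_zero_iff [simp]: "absval (x::'k::nonarch_valued_field) = 0 \<longleftrightarrow> x = 0"
  by (simp add: absval_eq_dist)

lemma absval_zero [simp]: "absval (0::'k::nonarch_valued_field) = 0"
  by simp

lemma absval_pos: "x \<noteq> 0 \<Longrightarrow> 0 < absval (x::'k::nonarch_valued_field)"
  by (simp add: absval_eq_dist)

lemma absval_one [simp]: "absval (1::'k::nonarch_valued_field) = 1"
  using absval_mult[of "1::'k" 1] absval_zero_iff[of "1::'k"] by simp

lemma absval_minus [simp]: "absval (- x) = absval (x::'k::nonarch_valued_field)"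
  using dist_absval[of 0 x] dist_absval[of x 0] by (simp add: dist_commute)

lemma absval_minus_commute: "absval (x - y) = absval (y - x :: 'k::nonarch_valued_field)"
  by (metis absval_minus minus_diff_eq)

lemma absval_power: "absval (x ^ k) = absval (x::'k::nonarch_valued_field) ^ k"
  by (induction k) (auto simp: absval_mult)

lemma absval_divide: "y \<noteq> 0 \<Longrightarrow> absval (x / y) = absval x / absval (y::'k::nonarch_valued_field)"
  by (metis absval_mult absval_zero_iff nonzero_eq_divide_eq)

lemma absval_add_le:
  "absval x \<le> r \<Longrightarrow> absval y \<le> r \<Longrightarrow> absval (x + y :: 'k::nonarch_valued_field) \<le> r"
  using absval_ultrametric[of x y] by simp

lemma absval_diff_le:
  "absval x \<le> r \<Longrightarrow> absval y \<le> r \<Longrightarrow> absval (x - y :: 'k::nonarch_valued_field) \<le> r"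
  using absval_add_le[of x r "-y"] by simp

lemma absval_trans_le:
  "absval (x - y) \<le> r \<Longrightarrow> absval (y - z) \<le> r \<Longrightarrow> absval (x - z :: 'k::nonarch_valued_field) \<le> r"
  using absval_add_le[of "x - y" r "y - z"] by simp

lemma absval_common_le:
  "absval (x - z) \<le> r \<Longrightarrow> absval (y - z) \<le> r \<Longrightarrow> absval (x - y :: 'k::nonarch_valued_field) \<le> r"
  using absval_diff_le[of "x - z" r "y - z"] by simp

lemma absval_sum_le:
  "0 \<le> r \<Longrightarrow> (\<And>a. a \<in> A \<Longrightarrow> absval (g a) \<le> r) \<Longrightarrow>
    absval (\<Sum>a\<in>A. g a :: 'k::nonarch_valued_field) \<le> r"
  by (induction A rule: infinite_finite_induct) (auto intro: absval_add_le)

lemma absval_mult_le: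
  "absval x \<le> r \<Longrightarrow> absval y \<le> 1 \<Longrightarrow> absval (x * y :: 'k::nonarch_valued_field) \<le> r"
  using mult_mono[of "absval x" r "absval y" 1]
  by (metis absval_mult absval_nonneg dual_order.trans mult.right_neutral zero_le_one)

lemma absval_mult_le':
  "absval x \<le> 1 \<Longrightarrow> absval y \<le> r \<Longrightarrow> absval (x * y :: 'k::nonarch_valued_field) \<le> r"
  using absval_mult_le[of y r x] by (simp add: mult.commute)

lemma absval_prod_le_one:
  "(\<And>a. a \<in> A \<Longrightarrow> absval (g a) \<le> 1) \<Longrightarrow> absval (\<Prod>a\<in>A. g a :: 'k::nonarch_valued_field) \<le> 1"
  by (induction A rule: infinite_finite_induct) (auto intro: absval_mult_le)

lemma absval_of_int_le_one: "absval (of_int m :: 'k::nonarch_valued_field) \<le> 1"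
proof -
  have nat: "absval (of_nat k :: 'k) \<le> 1" for k
    by (induction k) (auto intro: absval_add_le)
  show ?thesis
    by (cases m) (auto intro: nat simp del: of_nat_Suc)
qed

section \<open>Finiteness of \<open>R/pR\<close>\<close>

text \<open>
  Linear independence in \<open>K/pR\<close> over the field with \<open>p\<close> elements, expressed with integer
  coefficients so that it can be compared with linear independence over \<open>\<rat>\<close>.
\<close>

definition independent_mod :: "nat \<Rightarrow> 'k::nonarch_valued_field set \<Rightarrow> bool" where
  "independent_mod p S \<longleftrightarrow> finite S \<and>
     (\<forall>c. absval (\<Sum>s\<in>S. of_int (c s) * s) \<le> absval (of_nat p :: 'k) \<longrightarrow> (\<forall>s\<in>S. int p dvd c s))"

text \<open>
  The coefficients of a vanishing integer relation are divisible by \<open>p\<close>, and dividing them by \<open>p\<close>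
  gives another vanishing relation. By descent they are divisible by all powers of \<open>p\<close>.
\<close>

lemma independent_mod_no_int_relation:
  fixes S :: "'k::nonarch_valued_field set"
  assumes ind: "independent_mod p S" and p: "p > 1"
    and rel: "(\<Sum>s\<in>S. of_int (c s) * s) = 0" and s: "s \<in> S"
  shows "c s = 0"
proof -
  have "\<forall>s\<in>S. int p ^ k dvd c s" for k
    using rel
  proof (induction k arbitrary: c)
    case (Suc k)
    have "\<forall>s\<in>S. int p dvd c s"
      using ind Suc.prems unfolding independent_mod_def by simp
    then have "\<forall>s\<in>S. \<exists>e. c s = int p * e" by (simp add: dvd_def)
    then obtain d where d: "\<forall>s\<in>S. c s = int p * d s"
      using bchoice by meson
    have "of_nat p * (\<Sum>s\<in>S. of_int (d s) * s) = (\<Sum>s\<in>S. of_int (c s) * s)"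
      unfolding sum_distrib_left by (rule sum.cong) (use d in \<open>simp_all add: mult.assoc\<close>)
    then have "(\<Sum>s\<in>S. of_int (d s) * s) = 0"
      using Suc.prems p by simp
    then show ?case
      using Suc.IH[of d] d by simp
  qed simp
  then have "int p ^ k dvd c s" for k
    using s by blast
  moreover have "\<not> int p ^ nat \<bar>c s\<bar> dvd c s" if "c s \<noteq> 0"
  proof
    assume "int p ^ nat \<bar>c s\<bar> dvd c s"
    then have "int p ^ nat \<bar>c s\<bar> \<le> \<bar>c s\<bar>"
      using dvd_imp_le_int[OF that] by fastforce
    moreover have "nat \<bar>c s\<bar> < p ^ nat \<bar>c s\<bar>"
      using p by (simp add: power_gt_expt)
    then have "int (nat \<bar>c s\<bar>) < int (p ^ nat \<bar>c s\<bar>)" by (simp only: of_nat_less_iff)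
    ultimately show False by simp
  qed
  ultimately show ?thesis by blast
qed

lemma rat_common_denominator:
  assumes "finite S"
  obtains D :: int and c where "D \<noteq> 0" "\<And>s. s \<in> S \<Longrightarrow> of_int D * u s = (of_int (c s) :: rat)"
proof -
  define D where "D = (\<Prod>s\<in>S. snd (quotient_of (u s)))"
  have D0: "D \<noteq> 0"
    unfolding D_def using assms by (simp add: order.strict_implies_not_eq[OF quotient_of_denom_pos', symmetric])
  have "\<exists>m. of_int D * u s = (of_int m :: rat)" if "s \<in> S" for s
  proof -
    obtain a b where ab: "quotient_of (u s) = (a, b)" by (rule prod.exhaust)
    have "b dvd D"
      using dvd_prodI[OF assms that, of "\<lambda>s. snd (quotient_of (u s))"] ab by (simp add: D_def)
    then obtain e where "D = b * e" by blast
    moreover have "u s = of_int a / of_int b" "b \<noteq> 0"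
      using quotient_of_div[OF ab] quotient_of_denom_pos[OF ab] by simp_all
    ultimately have "of_int D * u s = of_int (a * e)" by simp
    then show ?thesis by blast
  qed
  then have "\<forall>s\<in>S. \<exists>m. of_int D * u s = (of_int m :: rat)" by blast
  then obtain c where "\<forall>s\<in>S. of_int D * u s = (of_int (c s) :: rat)"
    using bchoice by meson
  with D0 show ?thesis using that by blast
qed

lemma vector_space_over_rat:
  "vector_space (\<lambda>(r::rat) (x::'k::field_char_0). of_rat r * x)"
  by unfold_locales (simp_all add: distrib_left distrib_right of_rat_add of_rat_mult mult.assoc)

lemma card_independent_mod_le:
  fixes S :: "'k::nonarch_valued_field set"
  assumes ind: "independent_mod p S" and p: "p > 1" and B: "finite B"
    and span: "S \<subseteq> {\<Sum>b\<in>B. of_rat (r b) * b | r. True}"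
  shows "card S \<le> card B"
proof -
  interpret Q: vector_space "\<lambda>(r::rat) (x::'k). of_rat r * x"
    by (rule vector_space_over_rat)
  have fin: "finite S" using ind by (simp add: independent_mod_def)
  have "Q.independent S"
  proof
    assume "Q.dependent S"
    then obtain u v where u: "(\<Sum>s\<in>S. of_rat (u s) * s) = 0" "v \<in> S" "u v \<noteq> 0"
      using Q.dependent_finite[OF fin] by auto
    obtain D c where D: "D \<noteq> 0" and c: "\<And>s. s \<in> S \<Longrightarrow> of_int D * u s = (of_int (c s) :: rat)"
      using rat_common_denominator[OF fin] by metis
    have c': "of_int (c s) = (of_int D * of_rat (u s) :: 'k)" if "s \<in> S" for s
      using arg_cong[OF c[OF that], of "of_rat :: rat \<Rightarrow> 'k"] by (simp add: of_rat_mult)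
    have "(\<Sum>s\<in>S. of_int (c s) * s) = of_int D * (\<Sum>s\<in>S. of_rat (u s) * s)"
      by (simp add: c' sum_distrib_left mult.assoc)
    then have "c v = 0"
      using independent_mod_no_int_relation[OF ind p _ u(2)] u(1) by simp
    then show False using c[OF u(2)] D u(3) by simp
  qed
  moreover have "S \<subseteq> Q.span B"
  proof
    fix s assume "s \<in> S"
    then obtain r where "s = (\<Sum>b\<in>B. of_rat (r b) * b)" using span by blast
    moreover have "(\<Sum>b\<in>B. of_rat (r b) * b) \<in> Q.span B"
      by (rule Q.span_sum, rule Q.span_scale, rule Q.span_base)
    ultimately show "s \<in> Q.span B" by simp
  qed
  ultimately show ?thesis
    using Q.independent_span_bound[OF B] by blast
qed

text \<open>
  Every \<open>p\<close>-adic coefficient is a limit of rational ones; with finitely many basis elements the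
  resulting errors stay under control uniformly. This lets linear algebra over the type of rational
  numbers replace linear algebra over the subfield \<open>\<rat>\<^sub>p\<close>.
\<close>

lemma rational_span_dense:
  fixes B :: "'k::nonarch_valued_field set"
  assumes B: "finite B" and c: "\<forall>b\<in>B. c b \<in> padic_numbers" and e: "e > 0"
  obtains r where "absval ((\<Sum>b\<in>B. c b * b) - (\<Sum>b\<in>B. of_rat (r b) * b)) \<le> (e::real)"
proof -
  define M where "M = 1 + (\<Sum>b\<in>B. absval b)"
  have M: "M > 0" "\<And>b. b \<in> B \<Longrightarrow> absval b \<le> M"
  proof -
    have "0 \<le> (\<Sum>b\<in>B. absval b)" by (simp add: sum_nonneg)
    then show "M > 0" unfolding M_def by linarith
    show "absval b \<le> M" if "b \<in> B" for b
      using member_le_sum[of b B absval] that B unfolding M_def by fastforce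
  qed
  have "\<exists>r. absval (c b - of_rat r) < e / M" if "b \<in> B" for b
  proof -
    have "c b \<in> closure \<rat>" using c that by (simp add: padic_numbers_def)
    then obtain y where "y \<in> \<rat>" "dist y (c b) < e / M"
      using closure_approachable e M(1) by (metis divide_pos_pos)
    then show ?thesis
      by (metis Rats_cases dist_absval dist_commute)
  qed
  then obtain r where r: "\<And>b. b \<in> B \<Longrightarrow> absval (c b - of_rat (r b)) < e / M"
    by metis
  have "absval ((\<Sum>b\<in>B. c b * b) - (\<Sum>b\<in>B. of_rat (r b) * b))
      = absval (\<Sum>b\<in>B. (c b - of_rat (r b)) * b)"
    by (simp add: sum_subtractf left_diff_distrib)
  also have "\<dots> \<le> e"
  proof (rule absval_sum_le)
    fix b assume b: "b \<in> B"
    have "absval (c b - of_rat (r b)) * absval b \<le> e / M * M"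
      using r[OF b] M b e by (intro mult_mono) (auto simp: less_imp_le)
    then show "absval ((c b - of_rat (r b)) * b) \<le> e"
      using M(1) by (simp add: absval_mult)
  qed (use e in simp)
  finally show ?thesis using that by blast
qed

lemma absval_prime:
  assumes "padic_field p TYPE('k::nonarch_valued_field)"
  shows "absval (of_nat p :: 'k) = 1 / real p"
proof -
  have p: "prime p" and abs: "\<And>r. absval (of_rat r :: 'k) = padic_abs p r"
    using assms by (auto simp: padic_field_def)
  have "quotient_of (of_int (int p)) = (int p, 1)" by (rule quotient_of_rat_of_int)
  moreover have "multiplicity (int p) (int p) = 1"
    using p by (intro multiplicity_self) (auto dest: prime_gt_1_nat)
  moreover have "real p powi (- 1) = 1 / real p"
    by (simp add: power_int_def field_simps)
  ultimately have "padic_abs p (of_nat p) = 1 / real p"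
    using p by (auto simp: padic_abs_def)
  then show ?thesis using abs[of "of_nat p"] by simp
qed

text \<open>
  A set of integral elements that is independent modulo \<open>p\<close> and of greatest cardinality spans
  \<open>R/pR\<close>, so its combinations with coefficients in \<open>{0..<p}\<close> represent all classes.
\<close>

lemma finite_representatives_mod_p:
  assumes pf: "padic_field p TYPE('k::nonarch_valued_field)"
  shows "\<exists>F :: 'k set. finite F \<and> (\<forall>x. absval x \<le> 1 \<longrightarrow> (\<exists>y\<in>F. absval (x - y) \<le> 1 / real p))"
proof -
  have p: "prime p" using pf by (simp add: padic_field_def)
  then have p1: "p > 1" by (rule prime_gt_1_nat)
  then have le1: "1 / real p \<le> 1" by simp
  note absp = absval_prime[OF pf]
  obtain B :: "'k set" where B: "finite B"
    and gen: "\<And>x. \<exists>c. (\<forall>b\<in>B. c b \<in> padic_numbers) \<and> x = (\<Sum>b\<in>B. c b * b)"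
    using pf unfolding padic_field_def by blast
  define L where "L = {x. absval x \<le> 1} \<inter> {\<Sum>b\<in>B. of_rat (r b) * b | r. True}"
  have dense: "\<exists>y\<in>L. absval (x - y) \<le> 1 / real p" if "absval x \<le> 1" for x
  proof -
    obtain c where c: "\<forall>b\<in>B. c b \<in> padic_numbers" "x = (\<Sum>b\<in>B. c b * b)" using gen by blast
    obtain r where r: "absval (x - (\<Sum>b\<in>B. of_rat (r b) * b)) \<le> 1 / real p"
      using rational_span_dense[OF B c(1), of "1 / real p"] c(2) p1 by auto
    have "absval (x - (\<Sum>b\<in>B. of_rat (r b) * b)) \<le> 1"
      using r le1 by linarith
    then have "absval (\<Sum>b\<in>B. of_rat (r b) * b) \<le> 1"
      using absval_diff_le[OF that] by fastforce
    then show ?thesis using r unfolding L_def by blast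
  qed
  have "card S \<le> card B" if "independent_mod p S" "S \<subseteq> L" for S
    using card_independent_mod_le[OF that(1) p1 B] that(2) unfolding L_def by blast
  moreover have "independent_mod p ({} :: 'k set) \<and> {} \<subseteq> L"
    by (simp add: independent_mod_def)
  ultimately have "\<exists>S. (independent_mod p S \<and> S \<subseteq> L) \<and>
      (\<forall>S'. independent_mod p S' \<and> S' \<subseteq> L \<longrightarrow> card S' \<le> card S)"
    by (intro ex_has_greatest_nat[of _ "{}" card "Suc (card B)"]) (auto simp: less_Suc_eq_le)
  then obtain S where S: "independent_mod p S" "S \<subseteq> L"
    and maxS: "\<And>S'. independent_mod p S' \<Longrightarrow> S' \<subseteq> L \<Longrightarrow> card S' \<le> card S"
    by auto
  have finS: "finite S" using S by (simp add: independent_mod_def)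
  define F where "F = (\<lambda>d. \<Sum>s\<in>S. of_int (d s) * s) ` (S \<rightarrow>\<^sub>E {0..<int p})"
  have F: "\<exists>y\<in>F. absval (x - y) \<le> 1 / real p" if x: "x \<in> L" for x
  proof -
    have x1: "absval x \<le> 1" and S1: "\<And>s. s \<in> S \<Longrightarrow> absval s \<le> 1"
      using x S(2) by (auto simp: L_def)
    \<comment> \<open>A relation modulo \<open>p\<close> in which \<open>x\<close> has an invertible coefficient, by maximality of \<open>S\<close>.\<close>
    obtain c :: int and d where cd: "\<not> int p dvd c"
      "absval (of_int c * x - (\<Sum>s\<in>S. of_int (d s) * s)) \<le> 1 / real p"
    proof (cases "x \<in> S")
      case True
      have "(\<Sum>s\<in>S. of_int (if s = x then 1 else 0) * s) = (\<Sum>s\<in>S. if s = x then s else 0)"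
        by (intro sum.cong) auto
      also have "\<dots> = x" using True finS by simp
      finally show ?thesis
        using that[of 1 "\<lambda>s. if s = x then 1 else 0"] p1 by simp
    next
      case False
      have "\<not> independent_mod p (insert x S)"
        using maxS[of "insert x S"] False finS x S(2) by auto
      then obtain c where c: "absval (\<Sum>s\<in>insert x S. of_int (c s) * s) \<le> 1 / real p"
        "\<exists>s\<in>insert x S. \<not> int p dvd c s"
        using finS absp unfolding independent_mod_def by auto
      have c': "absval (of_int (c x) * x + (\<Sum>s\<in>S. of_int (c s) * s)) \<le> 1 / real p"
        using c(1) False finS by simp
      have "\<not> int p dvd c x"
      proof
        assume "int p dvd c x"
        then obtain m where "c x = int p * m" by blast
        then have "of_int (c x) * x = of_nat p * (of_int m * x)" by (simp add: mult.assoc)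
        moreover have "absval (of_nat p * (of_int m * x)) \<le> 1 / real p"
          by (rule absval_mult_le[OF _ absval_mult_le'[OF absval_of_int_le_one x1]]) (simp add: absp)
        ultimately have "absval (of_int (c x) * x) \<le> 1 / real p" by (simp only:)
        then have "absval (\<Sum>s\<in>S. of_int (c s) * s) \<le> 1 / real p"
          using absval_diff_le[OF c'] by fastforce
        then have "\<forall>s\<in>S. int p dvd c s"
          using S(1) absp unfolding independent_mod_def by simp
        with c(2) \<open>int p dvd c x\<close> show False by blast
      qed
      then show ?thesis
        using that[of "c x" "\<lambda>s. - c s"] c' by (simp add: sum_negf)
    qed
    have "coprime c (int p)"
      using cd(1) p prime_imp_coprime[of "int p" c] by (simp add: coprime_commute)
    then obtain c' m where "c' * c + m * int p = 1"
      using bezout_int[of c "int p"] by auto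
    then have inv: "c' * c = 1 + (- m) * int p" by simp
    define e where "e s = (c' * d s) mod int p" for s
    define y where "y = (\<Sum>s\<in>S. of_int (e s) * s)"
    have "y = (\<Sum>s\<in>S. of_int (restrict e S s) * s)" unfolding y_def by (intro sum.cong) auto
    moreover have "restrict e S \<in> S \<rightarrow>\<^sub>E {0..<int p}" using p1 by (auto simp: e_def)
    ultimately have yF: "y \<in> F" unfolding F_def by (rule image_eqI)
    have e: "of_int (c' * d s) = (of_int (e s) + of_nat p * of_int ((c' * d s) div int p) :: 'k)" for s
    proof -
      have "c' * d s = e s + int p * ((c' * d s) div int p)" by (simp add: e_def)
      from arg_cong[OF this, of "of_int :: int \<Rightarrow> 'k"] show ?thesis
        by (simp only: of_int_add of_int_mult of_int_of_nat_eq)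
    qed
    have eq: "x - y = of_int c' * (of_int c * x - (\<Sum>s\<in>S. of_int (d s) * s))
      + (of_nat p * (\<Sum>s\<in>S. of_int ((c' * d s) div int p) * s) - of_nat p * (of_int (- m) * x))"
    proof -
      have "of_int c' * (\<Sum>s\<in>S. of_int (d s) * s)
          = y + of_nat p * (\<Sum>s\<in>S. of_int ((c' * d s) div int p) * s)"
        unfolding y_def sum_distrib_left sum.distrib[symmetric]
        by (intro sum.cong refl) (use e in \<open>simp add: algebra_simps\<close>)
      moreover have "of_int c' * (of_int c * x) = of_int (c' * c) * x" by simp
      then have "of_int c' * (of_int c * x) = x + of_nat p * (of_int (- m) * x)"
        unfolding inv by (simp add: algebra_simps)
      ultimately show ?thesis by (simp add: right_diff_distrib)
    qed
    have mult_p: "absval z \<le> 1 \<Longrightarrow> absval (of_nat p * z) \<le> 1 / real p" for z :: 'k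
      by (rule absval_mult_le) (simp_all add: absp)
    have int_mult: "absval z \<le> r \<Longrightarrow> absval (of_int k * z) \<le> r" for k r and z :: 'k
      by (rule absval_mult_le'[OF absval_of_int_le_one])
    have "absval (\<Sum>s\<in>S. of_int ((c' * d s) div int p) * s) \<le> 1"
      by (rule absval_sum_le) (use int_mult S1 in simp_all)
    then have "absval (x - y) \<le> 1 / real p"
      unfolding eq by (intro absval_add_le absval_diff_le) (simp_all add: mult_p int_mult cd(2) x1)
    with yF show ?thesis by blast
  qed
  have "finite F" unfolding F_def using finS by (intro finite_imageI finite_PiE) auto
  moreover have "\<exists>y\<in>F. absval (x - y) \<le> 1 / real p" if "absval x \<le> 1" for x
    using dense[OF that] F by (metis absval_trans_le)
  ultimately show ?thesis by blast
qed

section \<open>Uniformizer and residue field\<close>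

lemma coset_eq_iff:
  fixes x y :: "'k::nonarch_valued_field"
  assumes "I = {x. absval x \<le> r}" "0 \<le> r"
  shows "coset I x = coset I y \<longleftrightarrow> absval (x - y) \<le> r"
proof
  assume "coset I x = coset I y"
  moreover have "x \<in> coset I x" unfolding coset_def assms(1) using assms(2) by (intro image_eqI[of _ _ 0]) auto
  ultimately show "absval (x - y) \<le> r" unfolding coset_def assms(1) by auto
next
  have *: "coset I x \<subseteq> coset I y" if "absval (x - y) \<le> r" for x y
  proof
    fix z assume "z \<in> coset I x"
    then obtain t where "z = x + t" "absval t \<le> r" by (auto simp: coset_def assms)
    then have "z = y + ((x - y) + t)" "absval ((x - y) + t) \<le> r"
      using that by (auto intro: absval_add_le)
    then show "z \<in> coset I y" unfolding coset_def assms by blast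
  qed
  assume "absval (x - y) \<le> r"
  then show "coset I x = coset I y"
    using *[of x y] *[of y x] by (simp add: absval_minus_commute)
qed

locale uniformizer =
  fixes \<pi> :: "'k::nonarch_valued_field"
  assumes uniformizer_nonzero: "\<pi> \<noteq> 0"
    and uniformizer_less: "absval \<pi> < 1"
    and uniformizer_greatest: "absval x < 1 \<Longrightarrow> absval (x::'k) \<le> absval \<pi>"
    and finite_residue_field: "finite (quotient_ring (max_ideal :: 'k set))"

text \<open>
  An absolute value in \<open>(1/p, 1)\<close> depends only on the class modulo \<open>p\<close>, so only finitely many
  occur. The largest one is attained at a uniformizer; if there is none, \<open>p\<close> itself is one.
\<close>

lemma padic_field_uniformizer:
  assumes pf: "padic_field p TYPE('k::nonarch_valued_field)"
  shows "\<exists>\<pi>::'k. uniformizer \<pi>"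
proof -
  have p1: "p > 1" using pf prime_gt_1_nat unfolding padic_field_def by blast
  note absp = absval_prime[OF pf]
  obtain F :: "'k set" where F: "finite F"
    "\<And>x. absval x \<le> 1 \<Longrightarrow> \<exists>y\<in>F. absval (x - y) \<le> 1 / real p"
    using finite_representatives_mod_p[OF pf] by blast
  define V where "V = insert (1 / real p) {v \<in> absval ` F. v < 1}"
  have fin: "finite V" "V \<noteq> {}" using F(1) by (auto simp: V_def)
  have "Max V \<in> V" using Max_in[OF fin] .
  then have "\<exists>\<pi>::'k. absval \<pi> = Max V" unfolding V_def
    using absp by auto
  then obtain \<pi> :: 'k where \<pi>: "absval \<pi> = Max V" by blast
  have ge: "absval \<pi> \<ge> 1 / real p" unfolding \<pi> using fin by (simp add: V_def)
  have lt: "absval \<pi> < 1" using \<open>Max V \<in> V\<close> p1 unfolding \<pi> by (auto simp: V_def)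
  have great: "absval x \<le> absval \<pi>" if x: "absval x < 1" for x :: 'k
  proof (cases "absval x \<le> 1 / real p")
    case True then show ?thesis using ge by simp
  next
    case False
    obtain y where y: "y \<in> F" "absval (x - y) \<le> 1 / real p" using F(2)[of x] x by auto
    have xy: "absval x \<le> max (absval (x - y)) (absval y)"
      using absval_ultrametric[of "x - y" y] by simp
    have "absval y \<le> max (absval (y - x)) (absval x)"
      using absval_ultrametric[of "y - x" x] by simp
    then have "absval y = absval x" using xy y(2) False by (simp add: absval_minus_commute)
    then have "absval x \<in> absval ` F" using y(1) by (metis imageI)
    then have "absval x \<in> V" using x by (simp add: V_def)
    then show ?thesis unfolding \<pi> using fin by simp
  qed
  have mi: "(max_ideal :: 'k set) = {x. absval x \<le> absval \<pi>}"
    using great lt by (auto simp: max_ideal_def)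
  have "quotient_ring (max_ideal :: 'k set) \<subseteq> coset max_ideal ` F"
  proof
    fix X :: "'k set" assume "X \<in> quotient_ring max_ideal"
    then obtain x where x: "X = coset max_ideal x" "absval x \<le> 1"
      by (auto simp: quotient_ring_def valuation_ring_def)
    then obtain y where "y \<in> F" "absval (x - y) \<le> absval \<pi>" using F(2)[of x] ge by force
    then show "X \<in> coset max_ideal ` F" using coset_eq_iff[OF mi] x by auto
  qed
  then have "finite (quotient_ring (max_ideal :: 'k set))"
    using F(1) finite_subset by blast
  moreover have "\<pi> \<noteq> 0" using ge p1 by auto
  ultimately show ?thesis using lt great by (auto simp: uniformizer_def)
qed

section \<open>Polynomial functions\<close>

text \<open>
  Polynomial functions over \<open>R\<close>, generated inductively: the expansion at a point can then be
  proved by induction, without manipulating multi-indices.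
\<close>

inductive_set poly_fun :: "('k::nonarch_valued_field ^ 'n::finite \<Rightarrow> 'k) set" where
  const: "absval c \<le> 1 \<Longrightarrow> (\<lambda>_. c) \<in> poly_fun"
| coord: "(\<lambda>x. x $ j) \<in> poly_fun"
| add: "f \<in> poly_fun \<Longrightarrow> g \<in> poly_fun \<Longrightarrow> (\<lambda>x. f x + g x) \<in> poly_fun"
| mult: "f \<in> poly_fun \<Longrightarrow> g \<in> poly_fun \<Longrightarrow> (\<lambda>x. f x * g x) \<in> poly_fun"

lemma poly_fun_sum: "(\<And>a. a \<in> A \<Longrightarrow> g a \<in> poly_fun) \<Longrightarrow> (\<lambda>x. \<Sum>a\<in>A. g a x) \<in> poly_fun"
  by (induction A rule: infinite_finite_induct) (auto intro: poly_fun.intros)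

lemma poly_fun_prod: "(\<And>a. a \<in> A \<Longrightarrow> g a \<in> poly_fun) \<Longrightarrow> (\<lambda>x. \<Prod>a\<in>A. g a x) \<in> poly_fun"
  by (induction A rule: infinite_finite_induct) (auto intro: poly_fun.intros)

lemma poly_fun_power: "f \<in> poly_fun \<Longrightarrow> (\<lambda>x. f x ^ k) \<in> poly_fun"
  by (induction k) (auto intro: poly_fun.intros)

lemma poly_fun_linear: "(\<And>j. absval (d j) \<le> 1) \<Longrightarrow> (\<lambda>x. \<Sum>j\<in>UNIV. d j * x $ j) \<in> poly_fun"
  by (intro poly_fun_sum poly_fun.intros) auto

lemma poly_fun_integral:
  "h \<in> poly_fun \<Longrightarrow> (\<And>j. absval (x $ j) \<le> 1) \<Longrightarrow> absval (h x) \<le> 1"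
  by (induction rule: poly_fun.induct) (auto intro: absval_add_le absval_mult_le)

lemma poly_fun_congruence:
  assumes "h \<in> poly_fun" and "\<And>j. absval (x $ j) \<le> 1" "\<And>j. absval (y $ j) \<le> 1"
    and "0 \<le> r" "\<And>j. absval (x $ j - y $ j) \<le> r"
  shows "absval (h x - h y) \<le> r"
  using assms(1)
proof (induction rule: poly_fun.induct)
  case (add f g)
  have eq: "f x + g x - (f y + g y) = (f x - f y) + (g x - g y)" by simp
  show ?case unfolding eq using add.IH by (rule absval_add_le)
next
  case (mult f g)
  have eq: "f x * g x - f y * g y = f x * (g x - g y) + (f x - f y) * g y"
    by (simp add: algebra_simps)
  have "absval (f x) \<le> 1" "absval (g y) \<le> 1"
    using poly_fun_integral mult.hyps assms(2,3) by blast+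
  then show ?case
    unfolding eq using mult.IH by (simp add: absval_add_le absval_mult_le absval_mult_le')
qed (use assms in auto)

text \<open>
  What matters is that the coefficients \<open>d\<close> and the remainder \<open>g\<close> are again defined over \<open>R\<close>.
  In the product case the remainder collects all terms of order at least two.
\<close>

lemma poly_fun_taylor:
  assumes "h \<in> poly_fun" and a: "\<And>j. absval (a $ j) \<le> 1" and t: "absval t \<le> 1"
  shows "\<exists>d g. (\<forall>j. absval (d j) \<le> 1) \<and> g \<in> poly_fun \<and>
    (\<forall>y. h (\<chi> j. a $ j + t * y $ j) = h a + t * (\<Sum>j\<in>UNIV. d j * y $ j) + t\<^sup>2 * g y)"
  using assms(1)
proof (induction rule: poly_fun.induct)
  case (const c)
  then show ?case by (intro exI[of _ "\<lambda>_. 0"]) (auto intro: poly_fun.const)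
next
  case (coord j)
  have "(\<Sum>k\<in>UNIV. (if k = j then 1 else 0) * y $ k) = y $ j" for y :: "'a ^ 'b"
    by (subst sum.cong[OF refl, of _ _ "\<lambda>k. if k = j then y $ k else 0"]) auto
  then show ?case
    by (intro exI[of _ "\<lambda>k. if k = j then 1 else 0"] exI[of _ "\<lambda>_. 0"]) (auto intro: poly_fun.const)
next
  case (add f f')
  from add.IH(1) obtain d g where d: "\<forall>j. absval (d j) \<le> 1" "g \<in> poly_fun" and
    e: "\<And>y. f (\<chi> j. a $ j + t * y $ j) = f a + t * (\<Sum>j\<in>UNIV. d j * y $ j) + t\<^sup>2 * g y"
    by blast
  from add.IH(2) obtain d' g' where d': "\<forall>j. absval (d' j) \<le> 1" "g' \<in> poly_fun" and
    e': "\<And>y. f' (\<chi> j. a $ j + t * y $ j) = f' a + t * (\<Sum>j\<in>UNIV. d' j * y $ j) + t\<^sup>2 * g' y"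
    by blast
  have "\<forall>j. absval (d j + d' j) \<le> 1" using d d' by (simp add: absval_add_le)
  moreover have "(\<lambda>y. g y + g' y) \<in> poly_fun" using d(2) d'(2) by (rule poly_fun.add)
  moreover have "f (\<chi> j. a $ j + t * y $ j) + f' (\<chi> j. a $ j + t * y $ j) =
      f a + f' a + t * (\<Sum>j\<in>UNIV. (d j + d' j) * y $ j) + t\<^sup>2 * (g y + g' y)" for y
    unfolding e e' by (simp add: distrib_right sum.distrib distrib_left)
  ultimately show ?case
    by (intro exI[of _ "\<lambda>j. d j + d' j"] exI[of _ "\<lambda>y. g y + g' y"]) simp
next
  case (mult f f')
  from mult.IH(1) obtain d g where d: "\<forall>j. absval (d j) \<le> 1" "g \<in> poly_fun" and
    e: "\<And>y. f (\<chi> j. a $ j + t * y $ j) = f a + t * (\<Sum>j\<in>UNIV. d j * y $ j) + t\<^sup>2 * g y"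
    by blast
  from mult.IH(2) obtain d' g' where d': "\<forall>j. absval (d' j) \<le> 1" "g' \<in> poly_fun" and
    e': "\<And>y. f' (\<chi> j. a $ j + t * y $ j) = f' a + t * (\<Sum>j\<in>UNIV. d' j * y $ j) + t\<^sup>2 * g' y"
    by blast
  define l l' where "l y = (\<Sum>j\<in>UNIV. d j * y $ j)" and "l' y = (\<Sum>j\<in>UNIV. d' j * y $ j)" for y
  define G where "G y = (f a * g' y + f' a * g y) + (l y * l' y + (t * (l y * g' y) + (t * (l' y * g y) + t\<^sup>2 * (g y * g' y))))" for y
  have fa: "absval (f a) \<le> 1" "absval (f' a) \<le> 1"
    using poly_fun_integral mult.hyps a by blast+
  have l: "l \<in> poly_fun" "l' \<in> poly_fun"
    unfolding l_def l'_def using d(1) d'(1) by (simp_all add: poly_fun_linear)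
  have "absval (t\<^sup>2) \<le> 1" using t by (simp add: absval_power power_le_one)
  then have "G \<in> poly_fun"
    unfolding G_def by (intro poly_fun.add poly_fun.mult poly_fun.const fa d d' l t)
  moreover have "\<forall>j. absval (f a * d' j + f' a * d j) \<le> 1"
    using fa d d' by (simp add: absval_add_le absval_mult_le)
  moreover have "f (\<chi> j. a $ j + t * y $ j) * f' (\<chi> j. a $ j + t * y $ j) =
     f a * f' a + t * (\<Sum>j\<in>UNIV. (f a * d' j + f' a * d j) * y $ j) + t\<^sup>2 * G y" for y
  proof -
    have "(\<Sum>j\<in>UNIV. (f a * d' j + f' a * d j) * y $ j) = f a * l' y + f' a * l y"
      by (simp add: l_def l'_def distrib_right sum.distrib sum_distrib_left mult.assoc)
    then show ?thesis
      unfolding e e' l_def[symmetric] l'_def[symmetric] G_def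
      by (simp add: algebra_simps power2_eq_square)
  qed
  ultimately show ?case
    by (intro exI[of _ "\<lambda>j. f a * d' j + f' a * d j"] exI[of _ G]) simp
qed

lemma has_sum_absvalD:
  fixes g :: "'b \<Rightarrow> 'k::nonarch_valued_field"
  assumes "(g has_sum s) UNIV" "e > 0"
  obtains X where "finite X" "\<And>Y. finite Y \<Longrightarrow> X \<subseteq> Y \<Longrightarrow> absval (sum g Y - s) < e"
proof -
  have "eventually (\<lambda>Y. dist (sum g Y) s < e) (finite_subsets_at_top UNIV)"
    using assms unfolding has_sum_def by (rule tendstoD)
  then show ?thesis
    using that unfolding eventually_finite_subsets_at_top dist_absval by auto
qed

text \<open>
  Convergence at the point \<open>(1, \<dots>, 1)\<close> forces all but finitely many coefficients to be small, and
  the monomials are bounded by \<open>1\<close> on \<open>R\<^sup>n\<close>; so one partial sum approximates \<open>f\<close> uniformly.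
\<close>

lemma rigid_analytic_approx_poly_fun:
  fixes f :: "'k::nonarch_valued_field ^ 'n::finite \<Rightarrow> 'k"
  assumes "rigid_analytic_over_R f" and e: "e > 0"
  obtains h where "h \<in> poly_fun" "\<And>x. (\<And>j. absval (x $ j) \<le> 1) \<Longrightarrow> absval (f x - h x) \<le> e"
proof -
  obtain c where ps: "is_power_series_of c f" and "range c \<subseteq> valuation_ring"
    using assms(1) unfolding rigid_analytic_over_R_def by blast
  then have cR: "absval (c m) \<le> 1" for m by (auto simp: valuation_ring_def)
  have c: "((\<lambda>m. c m * (\<Prod>j\<in>UNIV. (x $ j) ^ (m $ j))) has_sum f x) UNIV"
    if "\<And>j. absval (x $ j) \<le> 1" for x
    using ps that by (simp add: is_power_series_of_def valuation_ring_power_def valuation_ring_def)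
  have "(c has_sum f (\<chi> j. 1)) UNIV" using c[of "\<chi> j. 1"] by simp
  then obtain X where X: "finite X" "\<And>Y. finite Y \<Longrightarrow> X \<subseteq> Y \<Longrightarrow> absval (sum c Y - f (\<chi> j. 1)) < e"
    using has_sum_absvalD e by blast
  have small: "absval (c m) \<le> e" if "m \<notin> X" for m
  proof -
    \<comment> \<open>A coefficient is a difference of two partial sums that are both close to the limit.\<close>
    have eq: "c m = (sum c (insert m X) - f (\<chi> j. 1)) - (sum c X - f (\<chi> j. 1))"
      using that X(1) by simp
    have "absval (sum c (insert m X) - f (\<chi> j. 1)) \<le> e" "absval (sum c X - f (\<chi> j. 1)) \<le> e"
      using X(2)[of "insert m X"] X(2)[of X] X(1) by (simp_all add: subset_insertI less_imp_le)
    then show ?thesis unfolding eq by (rule absval_diff_le)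
  qed
  define h where "h x = (\<Sum>m\<in>X. c m * (\<Prod>j\<in>UNIV. (x $ j) ^ (m $ j)))" for x :: "'k ^ 'n"
  have "h \<in> poly_fun"
    unfolding h_def
    by (intro poly_fun_sum poly_fun.mult poly_fun.const cR poly_fun_prod poly_fun_power poly_fun.coord)
  moreover have "absval (f x - h x) \<le> e" if x: "\<And>j. absval (x $ j) \<le> 1" for x
  proof -
    define g where "g m = c m * (\<Prod>j\<in>UNIV. (x $ j) ^ (m $ j))" for m
    obtain Z where Z: "finite Z" "\<And>Y. finite Y \<Longrightarrow> Z \<subseteq> Y \<Longrightarrow> absval (sum g Y - f x) < e"
      using has_sum_absvalD[OF c[OF x] e] unfolding g_def by blast
    have eq: "f x - h x = (\<Sum>m\<in>Z - X. g m) - (sum g (Z \<union> X) - f x)"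
      using sum.subset_diff[of X "Z \<union> X" g] Z(1) X(1) by (simp add: h_def g_def Un_Diff)
    have "absval (\<Sum>m\<in>Z - X. g m) \<le> e"
      using e x small unfolding g_def
      by (intro absval_sum_le absval_mult_le absval_prod_le_one) (auto simp: absval_power power_le_one)
    moreover have "absval (sum g (Z \<union> X) - f x) \<le> e" using Z(2)[of "Z \<union> X"] Z(1) X(1) by (simp add: less_imp_le)
    ultimately show ?thesis unfolding eq by (rule absval_diff_le)
  qed
  ultimately show ?thesis using that by blast
qed

section \<open>Counting residue classes\<close>

lemma card_vec_box:
  fixes A :: "'n::finite \<Rightarrow> 'a set"
  shows "card {x :: 'a ^ 'n. \<forall>j. x $ j \<in> A j} = (\<Prod>j\<in>UNIV. card (A j))"
    and "(\<And>j. finite (A j)) \<Longrightarrow> finite {x :: 'a ^ 'n. \<forall>j. x $ j \<in> A j}"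
proof -
  have b: "bij_betw (\<lambda>g. \<chi> j. g j) (PiE UNIV A) {x :: 'a ^ 'n. \<forall>j. x $ j \<in> A j}"
    by (rule bij_betwI[of _ _ _ "\<lambda>x j. x $ j"]) (auto simp: PiE_def)
  show "card {x :: 'a ^ 'n. \<forall>j. x $ j \<in> A j} = (\<Prod>j\<in>UNIV. card (A j))"
    using bij_betw_same_card[OF b] card_PiE[of UNIV A] by simp
  show "finite {x :: 'a ^ 'n. \<forall>j. x $ j \<in> A j}" if "\<And>j. finite (A j)"
    using bij_betw_finite[OF b] finite_PiE[of UNIV A] that by simp
qed

context uniformizer
begin

abbreviation \<rho> :: real where "\<rho> \<equiv> absval \<pi>"

lemma rho_pos [simp]: "0 < \<rho>" using uniformizer_nonzero absval_pos by blast

lemma rho_power_le_one: "\<rho> ^ k \<le> 1"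
  using uniformizer_less by (simp add: power_le_one)

lemma absval_uniformizer_power_mult_le_iff:
  "absval (\<pi> ^ k * x) \<le> \<rho> ^ (k + l) \<longleftrightarrow> absval x \<le> \<rho> ^ l"
  by (simp add: absval_mult absval_power power_add)

lemma exists_multiple_uniformizer_power:
  assumes "absval x \<le> \<rho> ^ k"
  obtains y where "x = \<pi> ^ k * y" "absval y \<le> 1"
proof (rule that)
  show "x = \<pi> ^ k * (x / \<pi> ^ k)" using uniformizer_nonzero by simp
  show "absval (x / \<pi> ^ k) \<le> 1"
    using assms uniformizer_nonzero by (simp add: absval_divide absval_power)
qed

lemma max_ideal_eq: "max_ideal = {x :: 'k. absval x \<le> \<rho>}"
  using uniformizer_greatest uniformizer_less by (auto simp: max_ideal_def)

lemma max_ideal_power_eq: "max_ideal_power k = {x :: 'k. absval x \<le> \<rho> ^ k}"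
proof (induction k)
  case 0
  show ?case by (simp add: valuation_ring_def)
next
  case (Suc k)
  show ?case
  proof (intro equalityI subsetI)
    fix x :: 'k assume "x \<in> max_ideal_power (Suc k)"
    then obtain m :: nat and a b where "x = (\<Sum>j<m. a j * b j)"
      and "\<forall>j<m. absval (a j) \<le> \<rho>" "\<forall>j<m. absval (b j) \<le> \<rho> ^ k"
      unfolding max_ideal_power.simps Suc max_ideal_eq ideal_mult_def mem_Collect_eq
      by - (elim exE conjE, rule that)
    then show "x \<in> {x. absval x \<le> \<rho> ^ Suc k}"
      by (auto intro!: absval_sum_le mult_mono simp: absval_mult)
  next
    fix x :: 'k assume "x \<in> {x. absval x \<le> \<rho> ^ Suc k}"
    then obtain y where y: "x = \<pi> ^ Suc k * y" "absval y \<le> 1"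
      using exists_multiple_uniformizer_power by blast
    have "x = (\<Sum>j<1::nat. \<pi> * (\<pi> ^ k * y))" using y by simp
    moreover have "\<pi> \<in> max_ideal" by (simp add: max_ideal_eq)
    moreover have "\<pi> ^ k * y \<in> max_ideal_power k"
      using y unfolding Suc by (auto intro!: absval_mult_le simp: absval_power)
    ultimately show "x \<in> max_ideal_power (Suc k)"
      unfolding max_ideal_power.simps ideal_mult_def mem_Collect_eq
      by (intro exI[of _ 1] exI[of _ "\<lambda>_. \<pi>"] exI[of _ "\<lambda>_. \<pi> ^ k * y"]) auto
  qed
qed

lemma coset_max_ideal_power_eq_iff:
  fixes x y :: 'k
  shows "coset (max_ideal_power k) x = coset (max_ideal_power k) y \<longleftrightarrow> absval (x - y) \<le> \<rho> ^ k"
  by (rule coset_eq_iff[OF max_ideal_power_eq]) simp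

text \<open>
  Complete systems of representatives of \<open>R\<close> modulo \<open>P\<^sup>k\<close>. They turn counting tuples of cosets
  into counting tuples of elements of \<open>K\<close>, to which ring operations apply directly.
\<close>

definition reps :: "nat \<Rightarrow> 'k set \<Rightarrow> bool" where
  "reps k T \<longleftrightarrow> (\<forall>t\<in>T. absval t \<le> 1) \<and>
     (\<forall>x. absval x \<le> 1 \<longrightarrow> (\<exists>!t. t \<in> T \<and> absval (x - t) \<le> \<rho> ^ k))"

lemma repsD:
  assumes "reps k T"
  shows "t \<in> T \<Longrightarrow> absval t \<le> 1"
    and "absval x \<le> 1 \<Longrightarrow> \<exists>t\<in>T. absval (x - t) \<le> \<rho> ^ k"
    and "t \<in> T \<Longrightarrow> t' \<in> T \<Longrightarrow> absval (t - t') \<le> \<rho> ^ k \<Longrightarrow> t = t'"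
proof -
  show 1: "t \<in> T \<Longrightarrow> absval t \<le> 1" for t using assms by (auto simp: reps_def)
  show "absval x \<le> 1 \<Longrightarrow> \<exists>t\<in>T. absval (x - t) \<le> \<rho> ^ k" using assms by (auto simp: reps_def)
  assume t: "t \<in> T" "t' \<in> T" "absval (t - t') \<le> \<rho> ^ k"
  moreover have "absval (t - t) \<le> \<rho> ^ k" by simp
  ultimately show "t = t'" using assms 1[OF t(1)] unfolding reps_def by blast
qed

lemma repsI:
  assumes "\<And>t. t \<in> T \<Longrightarrow> absval t \<le> 1"
    and "\<And>x. absval x \<le> 1 \<Longrightarrow> \<exists>t\<in>T. absval (x - t) \<le> \<rho> ^ k"
    and "\<And>t t'. t \<in> T \<Longrightarrow> t' \<in> T \<Longrightarrow> absval (t - t') \<le> \<rho> ^ k \<Longrightarrow> t = t'"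
  shows "reps k T"
  unfolding reps_def
proof (intro conjI ballI allI impI)
  fix x :: 'k assume "absval x \<le> 1"
  then obtain t where t: "t \<in> T" "absval (x - t) \<le> \<rho> ^ k" using assms(2) by blast
  have "t' = t" if "t' \<in> T" "absval (x - t') \<le> \<rho> ^ k" for t'
    using assms(3)[OF that(1) t(1)] absval_trans_le[of t' x "\<rho> ^ k" t] t(2) that(2)
    by (simp add: absval_minus_commute)
  with t show "\<exists>!t. t \<in> T \<and> absval (x - t) \<le> \<rho> ^ k" by blast
qed (use assms(1) in blast)

lemma reps_residue_field:
  obtains T where "reps 1 T" "finite T" "card T = residue_card TYPE('k)"
proof -
  let ?P = "max_ideal :: 'k set"
  have "\<forall>X\<in>quotient_ring ?P. \<exists>x. absval x \<le> 1 \<and> coset ?P x = X"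
    by (auto simp: quotient_ring_def valuation_ring_def)
  then obtain r where r: "\<forall>X\<in>quotient_ring ?P. absval (r X) \<le> 1 \<and> coset ?P (r X) = X"
    using bchoice by meson
  have iff: "coset ?P x = coset ?P y \<longleftrightarrow> absval (x - y) \<le> \<rho> ^ 1" for x y :: 'k
    using coset_eq_iff[OF max_ideal_eq] by simp
  define T where "T = r ` quotient_ring ?P"
  have "reps 1 T"
  proof (rule repsI)
    fix x :: 'k assume "absval x \<le> 1"
    then have X: "coset ?P x \<in> quotient_ring ?P"
      by (auto simp: quotient_ring_def valuation_ring_def)
    then have "coset ?P x = coset ?P (r (coset ?P x))" using r by simp
    then have "absval (x - r (coset ?P x)) \<le> \<rho> ^ 1" by (simp only: iff)
    then show "\<exists>t\<in>T. absval (x - t) \<le> \<rho> ^ 1" unfolding T_def using X by blast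
  next
    fix t t' assume "t \<in> T" "t' \<in> T" and c: "absval (t - t') \<le> \<rho> ^ 1"
    then obtain X X' where X: "X \<in> quotient_ring ?P" "t = r X" "X' \<in> quotient_ring ?P" "t' = r X'"
      unfolding T_def by blast
    have "coset ?P t = coset ?P t'" using c iff by blast
    then show "t = t'" using r X by simp
  next
    fix t assume "t \<in> T"
    then show "absval t \<le> 1" using r unfolding T_def by blast
  qed
  moreover have "inj_on r (quotient_ring ?P)"
    by (rule inj_on_inverseI[of _ "coset ?P"]) (use r in blast)
  ultimately show ?thesis
    using that[of T] finite_residue_field by (simp add: T_def card_image residue_card_def)
qed

text \<open>
  Digit expansion: a class modulo \<open>P\<^bsup>k + l\<^esup>\<close> is a class modulo \<open>P\<^sup>k\<close> together with a class
  modulo \<open>P\<^sup>l\<close> of the quotient of the difference by \<open>\<pi>\<^sup>k\<close>.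
\<close>

lemma reps_digits:
  assumes T: "reps k T" and S: "reps l S"
  shows "reps (k + l) ((\<lambda>(t, s). t + \<pi> ^ k * s) ` (T \<times> S))"
    and "t \<in> T \<Longrightarrow> t' \<in> T \<Longrightarrow> s \<in> S \<Longrightarrow> s' \<in> S \<Longrightarrow> t + \<pi> ^ k * s = t' + \<pi> ^ k * s' \<Longrightarrow> t = t' \<and> s = s'"
proof -
  have mult_le: "absval (\<pi> ^ k * x) \<le> \<rho> ^ k" if "absval x \<le> 1" for x
    using that by (auto intro: absval_mult_le simp: absval_power)
  have uniq: "t = t' \<and> s = s'" if m: "t \<in> T" "t' \<in> T" "s \<in> S" "s' \<in> S"
    and c: "absval (t + \<pi> ^ k * s - (t' + \<pi> ^ k * s')) \<le> \<rho> ^ (k + l)" for t t' s s'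
  proof -
    have "\<rho> ^ (k + l) \<le> \<rho> ^ k"
      using rho_power_le_one[of l] by (simp add: power_add mult_left_le)
    then have "absval (t + \<pi> ^ k * s - (t' + \<pi> ^ k * s')) \<le> \<rho> ^ k" using c by simp
    moreover have "absval (\<pi> ^ k * (s' - s)) \<le> \<rho> ^ k"
      using mult_le m repsD(1)[OF S] absval_diff_le by blast
    moreover have "t - t' = (t + \<pi> ^ k * s - (t' + \<pi> ^ k * s')) + \<pi> ^ k * (s' - s)"
      by (simp add: algebra_simps)
    ultimately have "absval (t - t') \<le> \<rho> ^ k" by (metis absval_add_le)
    then have tt: "t = t'" using repsD(3)[OF T] m by blast
    then have "absval (\<pi> ^ k * (s - s')) \<le> \<rho> ^ (k + l)" using c by (simp add: algebra_simps)
    then show ?thesis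
      using tt repsD(3)[OF S] m absval_uniformizer_power_mult_le_iff by blast
  qed
  then show "t \<in> T \<Longrightarrow> t' \<in> T \<Longrightarrow> s \<in> S \<Longrightarrow> s' \<in> S \<Longrightarrow> t + \<pi> ^ k * s = t' + \<pi> ^ k * s' \<Longrightarrow> t = t' \<and> s = s'"
    by simp
  show "reps (k + l) ((\<lambda>(t, s). t + \<pi> ^ k * s) ` (T \<times> S))"
  proof (rule repsI)
    fix z assume "z \<in> (\<lambda>(t, s). t + \<pi> ^ k * s) ` (T \<times> S)"
    then obtain t s where "z = t + \<pi> ^ k * s" "t \<in> T" "s \<in> S" by auto
    then show "absval z \<le> 1"
      using repsD(1)[OF T] repsD(1)[OF S] mult_le rho_power_le_one[of k]
      by (metis absval_add_le order.trans)
  next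
    fix x :: 'k assume "absval x \<le> 1"
    then obtain t where t: "t \<in> T" "absval (x - t) \<le> \<rho> ^ k" using repsD(2)[OF T] by blast
    then obtain y where y: "x - t = \<pi> ^ k * y" "absval y \<le> 1"
      using exists_multiple_uniformizer_power by blast
    then obtain s where s: "s \<in> S" "absval (y - s) \<le> \<rho> ^ l" using repsD(2)[OF S] by blast
    have "x - (t + \<pi> ^ k * s) = \<pi> ^ k * (y - s)" using y by (simp add: algebra_simps)
    then have "absval (x - (t + \<pi> ^ k * s)) \<le> \<rho> ^ (k + l)"
      using s absval_uniformizer_power_mult_le_iff by metis
    then show "\<exists>z\<in>(\<lambda>(t, s). t + \<pi> ^ k * s) ` (T \<times> S). absval (x - z) \<le> \<rho> ^ (k + l)"
      using t s by auto
  next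
    fix z z' assume "z \<in> (\<lambda>(t, s). t + \<pi> ^ k * s) ` (T \<times> S)" "z' \<in> (\<lambda>(t, s). t + \<pi> ^ k * s) ` (T \<times> S)"
      and "absval (z - z') \<le> \<rho> ^ (k + l)"
    then show "z = z'" using uniq by auto
  qed
qed

lemma reps_exists: "\<exists>T. reps k T \<and> finite T \<and> card T = residue_card TYPE('k) ^ k"
proof (induction k)
  case 0
  have "reps 0 {0}" by (rule repsI) auto
  then show ?case by (intro exI[of _ "{0}"]) auto
next
  case (Suc k)
  then obtain T where T: "reps k T" "finite T" "card T = residue_card TYPE('k) ^ k" by blast
  obtain S where S: "reps 1 S" "finite S" "card S = residue_card TYPE('k)"
    using reps_residue_field by blast
  have "inj_on (\<lambda>(t, s). t + \<pi> ^ k * s) (T \<times> S)"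
    using reps_digits(2)[OF T(1) S(1)] by (auto simp: inj_on_def)
  then show ?case
    using reps_digits(1)[OF T(1) S(1)] T S
    by (intro exI[of _ "(\<lambda>(t, s). t + \<pi> ^ k * s) ` (T \<times> S)"]) (auto simp: card_image card_cartesian_product)
qed

text \<open>
  The quantity \<open>num_solutions\<close> with the congruence replaced by an arbitrary condition, because after
  the substitution \<open>x = a + \<pi> y\<close> the condition on \<open>y\<close> is a congruence modulo one power of \<open>P\<close>
  whereas the variables are taken modulo another.
\<close>

definition class_count :: "nat \<Rightarrow> ('k ^ 'n::finite \<Rightarrow> bool) \<Rightarrow> nat" where
  "class_count k Q = card {X :: 'k set ^ 'n. \<exists>x\<in>valuation_ring_power.
     X = (\<chi> j. coset (max_ideal_power k) (x $ j)) \<and> Q x}"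

definition periodic :: "nat \<Rightarrow> ('k ^ 'n::finite \<Rightarrow> bool) \<Rightarrow> bool" where
  "periodic k Q \<longleftrightarrow> (\<forall>x y. (\<forall>j. absval (x $ j) \<le> 1) \<longrightarrow> (\<forall>j. absval (y $ j) \<le> 1) \<longrightarrow>
     (\<forall>j. absval (x $ j - y $ j) \<le> \<rho> ^ k) \<longrightarrow> Q x \<longrightarrow> Q y)"

lemma class_count_cong:
  "(\<And>x. (\<And>j. absval (x $ j) \<le> 1) \<Longrightarrow> Q x \<longleftrightarrow> Q' x) \<Longrightarrow> class_count k Q = class_count k Q'"
  unfolding class_count_def
  by (rule arg_cong[of _ _ card]) (auto simp: valuation_ring_power_def valuation_ring_def)

lemma class_count_reps:
  fixes Q :: "'k ^ 'n::finite \<Rightarrow> bool"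
  assumes T: "reps k T" and Q: "periodic k Q"
  shows "class_count k Q = card {x. (\<forall>j. x $ j \<in> T) \<and> Q x}"
proof -
  define cl where "cl x = (\<chi> j. coset (max_ideal_power k) (x $ j))" for x :: "'k ^ 'n"
  have cl: "cl x = cl y \<longleftrightarrow> (\<forall>j. absval (x $ j - y $ j) \<le> \<rho> ^ k)" for x y
    by (simp add: cl_def vec_eq_iff coset_max_ideal_power_eq_iff)
  have "inj_on cl {x. (\<forall>j. x $ j \<in> T) \<and> Q x}"
  proof (rule inj_onI)
    fix x y assume x: "x \<in> {x. (\<forall>j. x $ j \<in> T) \<and> Q x}" and y: "y \<in> {x. (\<forall>j. x $ j \<in> T) \<and> Q x}"
      and "cl x = cl y"
    then have "absval (x $ j - y $ j) \<le> \<rho> ^ k" for j by (simp add: cl)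
    then show "x = y" using repsD(3)[OF T] x y by (simp add: vec_eq_iff)
  qed
  moreover have "x \<in> valuation_ring_power" if "\<forall>j. x $ j \<in> T" for x :: "'k ^ 'n"
    using that repsD(1)[OF T] by (simp add: valuation_ring_power_def valuation_ring_def)
  then have "cl ` {x. (\<forall>j. x $ j \<in> T) \<and> Q x} =
      {X. \<exists>x\<in>valuation_ring_power. X = cl x \<and> Q x}"
  proof (intro equalityI subsetI)
    fix X assume "X \<in> {X. \<exists>x\<in>valuation_ring_power. X = cl x \<and> Q x}"
    then obtain x where x: "\<And>j. absval (x $ j) \<le> 1" "X = cl x" "Q x"
      by (auto simp: valuation_ring_power_def valuation_ring_def)
    then have "\<forall>j. \<exists>t. t \<in> T \<and> absval (x $ j - t) \<le> \<rho> ^ k"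
      using repsD(2)[OF T] by blast
    then obtain t where t: "\<And>j. t j \<in> T" "\<And>j. absval (x $ j - t j) \<le> \<rho> ^ k" by metis
    have "Q (\<chi> j. t j)"
      using Q[unfolded periodic_def, rule_format, of x "\<chi> j. t j"] x t repsD(1)[OF T] by simp
    moreover have "X = cl (\<chi> j. t j)" using x t by (simp add: cl)
    ultimately show "X \<in> cl ` {x. (\<forall>j. x $ j \<in> T) \<and> Q x}" using t by auto
  qed blast
  ultimately show ?thesis
    unfolding class_count_def cl_def[symmetric] using card_image by fastforce
qed

text \<open>
  Used twice: with \<open>k = 1\<close> it sorts solutions by their class modulo \<open>P\<close>, and with \<open>l = 1\<close> it
  counts the lifts of solutions by one further digit.
\<close>

lemma class_count_split:
  fixes Q :: "'k ^ 'n::finite \<Rightarrow> bool"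
  assumes T: "reps k T" "finite T" and Q: "periodic (k + l) Q"
  shows "class_count (k + l) Q =
    (\<Sum>a\<in>{a. \<forall>j. a $ j \<in> T}. class_count l (\<lambda>y. Q (\<chi> j. a $ j + \<pi> ^ k * y $ j)))"
proof -
  obtain S where S: "reps l S" "finite S" using reps_exists by blast
  let ?U = "(\<lambda>(t, s). t + \<pi> ^ k * s) ` (T \<times> S)"
  let ?A = "{a :: 'k ^ 'n. \<forall>j. a $ j \<in> T}"
  let ?Y = "\<lambda>a. {y :: 'k ^ 'n. (\<forall>j. y $ j \<in> S) \<and> Q (\<chi> j. a $ j + \<pi> ^ k * y $ j)}"
  let ?\<phi> = "\<lambda>(a :: 'k ^ 'n, y). (\<chi> j. a $ j + \<pi> ^ k * y $ j)"
  have per: "periodic l (\<lambda>y. Q (\<chi> j. a $ j + \<pi> ^ k * y $ j))" if "a \<in> ?A" for a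
    unfolding periodic_def
  proof (intro allI impI)
    fix x y :: "'k ^ 'n"
    assume x: "\<forall>j. absval (x $ j) \<le> 1" and y: "\<forall>j. absval (y $ j) \<le> 1"
      and xy: "\<forall>j. absval (x $ j - y $ j) \<le> \<rho> ^ l"
      and Qx: "Q (\<chi> j. a $ j + \<pi> ^ k * x $ j)"
    have pk: "absval (\<pi> ^ k) \<le> 1" by (simp add: absval_power rho_power_le_one)
    have "absval (a $ j) \<le> 1" for j using that repsD(1)[OF T(1)] by auto
    then have in1: "\<And>j. absval (a $ j + \<pi> ^ k * x $ j) \<le> 1" "\<And>j. absval (a $ j + \<pi> ^ k * y $ j) \<le> 1"
      using x y pk by (auto intro!: absval_add_le absval_mult_le)
    have "a $ j + \<pi> ^ k * x $ j - (a $ j + \<pi> ^ k * y $ j) = \<pi> ^ k * (x $ j - y $ j)" for j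
      by (simp add: algebra_simps)
    then have "absval (a $ j + \<pi> ^ k * x $ j - (a $ j + \<pi> ^ k * y $ j)) \<le> \<rho> ^ (k + l)" for j
      using xy absval_uniformizer_power_mult_le_iff by metis
    then show "Q (\<chi> j. a $ j + \<pi> ^ k * y $ j)"
      using Q[unfolded periodic_def, rule_format,
          of "\<chi> j. a $ j + \<pi> ^ k * x $ j" "\<chi> j. a $ j + \<pi> ^ k * y $ j"] in1 Qx by simp
  qed
  have inj: "inj_on ?\<phi> (Sigma ?A ?Y)"
  proof (rule inj_onI)
    fix v v' assume v: "v \<in> Sigma ?A ?Y" "v' \<in> Sigma ?A ?Y" and "?\<phi> v = ?\<phi> v'"
    moreover obtain a y b z where ab: "v = (a, y)" "v' = (b, z)" by (metis prod.exhaust)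
    ultimately have "(\<chi> j. a $ j + \<pi> ^ k * y $ j) = (\<chi> j. b $ j + \<pi> ^ k * z $ j)" by simp
    then have "a $ j + \<pi> ^ k * y $ j = b $ j + \<pi> ^ k * z $ j" for j
      by (simp add: vec_eq_iff)
    moreover have "a $ j \<in> T" "b $ j \<in> T" "y $ j \<in> S" "z $ j \<in> S" for j
      using v by (simp_all add: ab)
    ultimately have "a $ j = b $ j \<and> y $ j = z $ j" for j
      by (intro reps_digits(2)[OF T(1) S(1)])
    then show "v = v'" by (simp add: ab vec_eq_iff)
  qed
  have im: "?\<phi> ` Sigma ?A ?Y = {x. (\<forall>j. x $ j \<in> ?U) \<and> Q x}"
  proof (intro equalityI subsetI)
    fix x assume x: "x \<in> {x. (\<forall>j. x $ j \<in> ?U) \<and> Q x}"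
    have "\<exists>t s. t \<in> T \<and> s \<in> S \<and> x $ j = t + \<pi> ^ k * s" for j
    proof -
      have "x $ j \<in> ?U" using x by simp
      then show ?thesis by auto
    qed
    then obtain t s where ts: "\<And>j. t j \<in> T" "\<And>j. s j \<in> S" "\<And>j. x $ j = t j + \<pi> ^ k * s j" by metis
    then have eq: "x = (\<chi> j. t j + \<pi> ^ k * s j)" by (simp add: vec_eq_iff)
    have "x = ?\<phi> (\<chi> j. t j, \<chi> j. s j)" by (simp add: eq)
    moreover have "(\<chi> j. t j, \<chi> j. s j) \<in> Sigma ?A ?Y" using ts x eq by simp
    ultimately show "x \<in> ?\<phi> ` Sigma ?A ?Y" by (rule image_eqI)
  next
    fix x assume "x \<in> ?\<phi> ` Sigma ?A ?Y"
    then obtain a y where a: "a \<in> ?A" "y \<in> ?Y a" and x: "x = (\<chi> j. a $ j + \<pi> ^ k * y $ j)" by auto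
    have "x $ j \<in> ?U" for j
      using a by (intro image_eqI[of _ _ "(a $ j, y $ j)"]) (simp_all add: x)
    then show "x \<in> {x. (\<forall>j. x $ j \<in> ?U) \<and> Q x}" using a x by simp
  qed
  have "class_count (k + l) Q = card {x. (\<forall>j. x $ j \<in> ?U) \<and> Q x}"
    by (rule class_count_reps[OF reps_digits(1)[OF T(1) S(1)] Q])
  also have "\<dots> = card (Sigma ?A ?Y)" using card_image[OF inj] im by simp
  also have "\<dots> = (\<Sum>a\<in>?A. card (?Y a))"
  proof (rule card_SigmaI)
    show "finite ?A" using card_vec_box(2)[of "\<lambda>_. T"] T by simp
    show "\<forall>a\<in>?A. finite (?Y a)"
      using card_vec_box(2)[of "\<lambda>_. S"] S by (auto intro: rev_finite_subset)
  qed
  also have "\<dots> = (\<Sum>a\<in>?A. class_count l (\<lambda>y. Q (\<chi> j. a $ j + \<pi> ^ k * y $ j)))"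
    by (intro sum.cong refl class_count_reps[OF S(1) per, symmetric])
  finally show ?thesis .
qed

lemma class_count_Suc_periodic:
  fixes Q :: "'k ^ 'n::finite \<Rightarrow> bool"
  assumes Q: "periodic k Q"
  shows "class_count (Suc k) Q = residue_card TYPE('k) ^ CARD('n) * class_count k Q"
proof -
  obtain T where T: "reps k T" "finite T" using reps_exists by blast
  obtain S where S: "reps 1 S" "card S = residue_card TYPE('k)"
    using reps_residue_field by blast
  let ?A = "{a :: 'k ^ 'n. \<forall>j. a $ j \<in> T}"
  have finA: "finite ?A" using card_vec_box(2)[of "\<lambda>_. T"] T by simp
  have shift: "absval (x $ j) \<le> 1 \<Longrightarrow> absval (\<pi> ^ k * x $ j) \<le> \<rho> ^ k" for x :: "'k ^ 'n" and j
    by (auto intro: absval_mult_le simp: absval_power)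
  have Qshift: "Q (\<chi> j. a $ j + \<pi> ^ k * y $ j) \<longleftrightarrow> Q a"
    if a: "a \<in> ?A" and y: "\<And>j. absval (y $ j) \<le> 1" for a y
  proof -
    have a1: "\<And>j. absval (a $ j) \<le> 1" using a repsD(1)[OF T(1)] by auto
    moreover have "\<And>j. absval (a $ j + \<pi> ^ k * y $ j) \<le> 1"
      using a1 shift[OF y] rho_power_le_one by (meson absval_add_le order.trans)
    ultimately show ?thesis
      using Q[unfolded periodic_def, rule_format, of a "\<chi> j. a $ j + \<pi> ^ k * y $ j"]
        Q[unfolded periodic_def, rule_format, of "\<chi> j. a $ j + \<pi> ^ k * y $ j" a] shift[OF y]
      by auto
  qed
  have "\<rho> ^ Suc k \<le> \<rho> ^ k" using uniformizer_less by (simp add: mult_left_le_one_le)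
  then have "periodic (k + 1) Q"
    using Q unfolding periodic_def by (metis Suc_eq_plus1 order.trans)
  then have "class_count (k + 1) Q =
      (\<Sum>a\<in>?A. class_count 1 (\<lambda>y. Q (\<chi> j. a $ j + \<pi> ^ k * y $ j)))"
    using class_count_split[OF T] by blast
  also have "\<dots> = (\<Sum>a\<in>?A. if Q a then residue_card TYPE('k) ^ CARD('n) else 0)"
  proof (rule sum.cong[OF refl])
    fix a assume a: "a \<in> ?A"
    have "class_count 1 (\<lambda>y. Q (\<chi> j. a $ j + \<pi> ^ k * y $ j)) = class_count 1 (\<lambda>_ :: 'k ^ 'n. Q a)"
      using Qshift[OF a] by (rule class_count_cong)
    also have "\<dots> = card {x :: 'k ^ 'n. (\<forall>j. x $ j \<in> S) \<and> Q a}"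
      by (rule class_count_reps[OF S(1)]) (simp add: periodic_def)
    also have "\<dots> = (if Q a then residue_card TYPE('k) ^ CARD('n) else 0)"
      using card_vec_box(1)[of "\<lambda>_::'n. S"] S(2) by simp
    finally show "class_count 1 (\<lambda>y. Q (\<chi> j. a $ j + \<pi> ^ k * y $ j)) = \<dots>" .
  qed
  also have "\<dots> = residue_card TYPE('k) ^ CARD('n) * card {a \<in> ?A. Q a}"
    using finA by (simp add: sum.If_cases Int_def)
  also have "{a \<in> ?A. Q a} = {x. (\<forall>j. x $ j \<in> T) \<and> Q x}" by auto
  finally show ?thesis using class_count_reps[OF T(1) Q] by simp
qed

section \<open>Solutions of polynomial congruences\<close>

lemma periodic_congruence:
  fixes h :: "'k ^ 'n::finite \<Rightarrow> 'k"
  assumes "h \<in> poly_fun"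
  shows "periodic k (\<lambda>x. absval (h x - w) \<le> \<rho> ^ k)"
  unfolding periodic_def
proof (intro allI impI)
  fix x y :: "'k ^ 'n"
  assume "\<forall>j. absval (x $ j) \<le> 1" "\<forall>j. absval (y $ j) \<le> 1"
    "\<forall>j. absval (x $ j - y $ j) \<le> \<rho> ^ k" and x: "absval (h x - w) \<le> \<rho> ^ k"
  then have "absval (h x - h y) \<le> \<rho> ^ k"
    using poly_fun_congruence[OF assms, of x y "\<rho> ^ k"] by simp
  then have "absval (h y - h x) \<le> \<rho> ^ k" by (subst absval_minus_commute)
  then show "absval (h y - w) \<le> \<rho> ^ k" using x by (rule absval_trans_le)
qed

text \<open>
  If the coordinates other than the \<open>i\<close>-th are kept fixed, the left-hand side is an injective
  function of the \<open>i\<close>-th coordinate modulo \<open>P\<^sup>k\<close>: changing this coordinate changes the linear part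
  by exactly as much, and \<open>\<pi> g\<close> by strictly less. As there are finitely many classes, the function
  is bijective, so that projecting along the \<open>i\<close>-th coordinate is a bijection from the solutions.
\<close>

lemma class_count_hensel:
  fixes d :: "'n::finite \<Rightarrow> 'k"
  assumes d: "\<And>j. absval (d j) \<le> 1" and i: "absval (d i) = 1"
    and g: "g \<in> poly_fun" and w: "absval w \<le> 1"
  shows "class_count k (\<lambda>y. absval ((\<Sum>j\<in>UNIV. d j * y $ j) + \<pi> * g y - w) \<le> \<rho> ^ k)
    = residue_card TYPE('k) ^ (k * (CARD('n) - 1))"
proof -
  define h where "h y = (\<Sum>j\<in>UNIV. d j * y $ j) + \<pi> * g y" for y
  have h: "h \<in> poly_fun"
    unfolding h_def using d g uniformizer_less
    by (intro poly_fun.add poly_fun.mult poly_fun_linear poly_fun.const) auto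
  obtain T where T: "reps k T" "finite T" "card T = residue_card TYPE('k) ^ k"
    using reps_exists by blast
  obtain t0 where t0: "t0 \<in> T" using repsD(2)[OF T(1), of 0] by auto
  define upd where "upd y t = (\<chi> j. if j = i then t else y $ j)" for y :: "'k ^ 'n" and t :: 'k
  \<comment> \<open>In \<open>Z\<close> the \<open>i\<close>-th coordinate is frozen at \<open>t0\<close>, leaving \<open>n - 1\<close> free coordinates.\<close>
  define Z where "Z = {y :: 'k ^ 'n. \<forall>j. y $ j \<in> (if j = i then {t0} else T)}"
  define Y where "Y = {y. (\<forall>j. y $ j \<in> T) \<and> absval (h y - w) \<le> \<rho> ^ k}"
  have T1: "\<And>t. t \<in> T \<Longrightarrow> absval t \<le> 1" using repsD(1)[OF T(1)] .
  have cancel: "absval (t - t') \<le> \<rho> ^ k"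
    if y: "\<forall>j. j \<noteq> i \<longrightarrow> absval (y $ j) \<le> 1" and t: "absval t \<le> 1" "absval t' \<le> 1"
      and e: "absval (h (upd y t) - h (upd y t')) \<le> \<rho> ^ k" for y t t'
  proof -
    have "absval (g (upd y t) - g (upd y t')) \<le> absval (t - t')"
      using y t by (intro poly_fun_congruence[OF g]) (auto simp: upd_def)
    then have small: "absval (\<pi> * (g (upd y t) - g (upd y t'))) \<le> \<rho> * absval (t - t')"
      by (simp add: absval_mult)
    have "(\<Sum>j\<in>UNIV. d j * upd y t $ j) - (\<Sum>j\<in>UNIV. d j * upd y t' $ j)
        = (\<Sum>j\<in>UNIV. if j = i then d i * (t - t') else 0)"
      unfolding sum_subtractf[symmetric] by (intro sum.cong) (auto simp: upd_def algebra_simps)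
    then have eq: "d i * (t - t') = (h (upd y t) - h (upd y t')) - \<pi> * (g (upd y t) - g (upd y t'))"
      by (simp add: h_def algebra_simps)
    have "absval (t - t') = absval (d i * (t - t'))" using i by (simp add: absval_mult)
    also have "\<dots> \<le> max (\<rho> ^ k) (\<rho> * absval (t - t'))"
      unfolding eq by (rule absval_diff_le) (use e small in \<open>simp_all add: le_max_iff_disj\<close>)
    finally have "absval (t - t') \<le> \<rho> ^ k \<or> absval (t - t') \<le> \<rho> * absval (t - t')" by auto
    then show ?thesis
    proof
      assume le: "absval (t - t') \<le> \<rho> * absval (t - t')"
      have "\<not> 0 < absval (t - t')"
      proof
        assume "0 < absval (t - t')"
        from mult_strict_right_mono[OF uniformizer_less this] le show False by simp
      qed
      then have "absval (t - t') = 0" using absval_nonneg[of "t - t'"] by linarith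
      then show ?thesis by simp
    qed
  qed
  have updT: "upd y t $ j \<in> T" if "\<And>j. j \<noteq> i \<Longrightarrow> y $ j \<in> T" "t \<in> T" for y t j
    using that by (auto simp: upd_def)
  have "bij_betw (\<lambda>y. upd y t0) Y Z"
    unfolding bij_betw_def
  proof
    show "inj_on (\<lambda>y. upd y t0) Y"
    proof (rule inj_onI)
      fix x y assume x: "x \<in> Y" and y: "y \<in> Y" and e: "upd x t0 = upd y t0"
      have same: "j \<noteq> i \<Longrightarrow> x $ j = y $ j" for j
        using arg_cong[OF e, of "\<lambda>v. v $ j"] by (simp add: upd_def)
      have "upd x (x $ i) = x" "upd x (y $ i) = y" using same by (auto simp: upd_def vec_eq_iff)
      moreover have "absval (h x - h y) \<le> \<rho> ^ k"
        using x y absval_common_le[of "h x" w "\<rho> ^ k" "h y"] by (simp add: Y_def)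
      ultimately have "absval (x $ i - y $ i) \<le> \<rho> ^ k"
        using cancel[of x "x $ i" "y $ i"] x y T1 by (auto simp: Y_def)
      then have "x $ i = y $ i" using repsD(3)[OF T(1)] x y by (auto simp: Y_def)
      then have "x $ j = y $ j" for j using same by (cases "j = i") auto
      then show "x = y" by (simp add: vec_eq_iff)
    qed
    show "(\<lambda>y. upd y t0) ` Y = Z"
    proof (intro equalityI subsetI)
      fix z assume z: "z \<in> Z"
      have zT: "j \<noteq> i \<Longrightarrow> z $ j \<in> T" for j using z by (auto simp: Z_def split: if_splits)
      have "\<exists>s. s \<in> T \<and> absval (h (upd z t) - s) \<le> \<rho> ^ k" if "t \<in> T" for t
      proof -
        have "absval (h (upd z t)) \<le> 1"
          by (rule poly_fun_integral[OF h]) (rule T1[OF updT[OF zT that]])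
        then show ?thesis using repsD(2)[OF T(1)] by blast
      qed
      then have "\<forall>t\<in>T. \<exists>s. s \<in> T \<and> absval (h (upd z t) - s) \<le> \<rho> ^ k" by blast
      then obtain r where "\<forall>t\<in>T. r t \<in> T \<and> absval (h (upd z t) - r t) \<le> \<rho> ^ k"
        using bchoice by meson
      then have r: "\<And>t. t \<in> T \<Longrightarrow> r t \<in> T \<and> absval (h (upd z t) - r t) \<le> \<rho> ^ k" by blast
      have "inj_on r T"
      proof (rule inj_onI)
        fix t t' assume t: "t \<in> T" "t' \<in> T" "r t = r t'"
        have "absval (h (upd z t) - h (upd z t')) \<le> \<rho> ^ k"
          using absval_common_le[of "h (upd z t)" "r t" "\<rho> ^ k" "h (upd z t')"]
            r[OF t(1)] r[OF t(2)] t(3) by simp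
        then have "absval (t - t') \<le> \<rho> ^ k" using cancel[of z t t'] zT T1 t by auto
        then show "t = t'" using repsD(3)[OF T(1)] t by blast
      qed
      then have surj: "r ` T = T" using r T(2) by (intro endo_inj_surj) auto
      obtain s where s: "s \<in> T" "absval (w - s) \<le> \<rho> ^ k" using repsD(2)[OF T(1) w] by blast
      then have "s \<in> r ` T" unfolding surj by simp
      then obtain t where t: "t \<in> T" "r t = s" by blast
      have "absval (h (upd z t) - w) \<le> \<rho> ^ k"
        using absval_common_le[of "h (upd z t)" s "\<rho> ^ k" w] r[OF t(1)] t(2) s(2) by simp
      then have "upd z t \<in> Y" using updT[OF zT t(1)] by (auto simp: Y_def)
      moreover have "z $ i = t0" using z by (simp add: Z_def split: if_splits)
      then have "upd (upd z t) t0 = z" by (simp add: upd_def vec_eq_iff)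
      ultimately show "z \<in> (\<lambda>y. upd y t0) ` Y" by (intro image_eqI[of _ _ "upd z t"]) simp_all
    qed (auto simp: Y_def Z_def upd_def)
  qed
  then have "card Y = card Z" by (rule bij_betw_same_card)
  also have "\<dots> = (\<Prod>j\<in>UNIV. card (if j = i then {t0} else T))"
    unfolding Z_def by (rule card_vec_box)
  also have "\<dots> = (\<Prod>j\<in>UNIV - {i}. card T)"
    by (subst prod.remove[of _ i]) (auto intro!: prod.cong)
  also have "\<dots> = residue_card TYPE('k) ^ (k * (CARD('n) - 1))"
    by (simp add: T(3) power_mult card_Diff_singleton)
  finally show ?thesis
    using class_count_reps[OF T(1) periodic_congruence[OF h]] unfolding Y_def h_def by simp
qed

text \<open>
  The exponent \<open>(n (i - 1) + 1) div 2\<close> is \<open>\<lceil>(n/2)(i - 1)\<rceil>\<close> in natural numbers. For \<open>i = 0\<close> the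
  truncated subtraction makes it \<open>0\<close>, so that \<open>i = 2\<close> can be reduced to \<open>i = 0\<close> by the same
  argument as the larger cases.
\<close>

lemma residue_card_power_dvd_class_count:
  fixes h :: "'k ^ 'n::finite \<Rightarrow> 'k"
  assumes n: "CARD('n) > 1" and "h \<in> poly_fun"
  shows "residue_card TYPE('k) ^ ((CARD('n) * (i - 1) + 1) div 2)
    dvd class_count i (\<lambda>x. absval (h x - w) \<le> \<rho> ^ i)"
  using assms(2)
proof (induction i arbitrary: h w rule: less_induct)
  case (less i)
  let ?q = "residue_card TYPE('k)" and ?n = "CARD('n)"
  show ?case
  proof (cases "i \<le> 1")
    case True
    then show ?thesis by simp
  next
    case False
    define k where "k = i - 2"
    have i: "i = Suc (Suc k)" using False by (simp add: k_def)
    obtain T where T: "reps 1 T" "finite T" using reps_exists by blast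
    have "?q ^ ((?n * (i - 1) + 1) div 2) dvd
       class_count (Suc k) (\<lambda>y. absval (h (\<chi> j. a $ j + \<pi> ^ 1 * y $ j) - w) \<le> \<rho> ^ i)"
      if a: "\<forall>j. a $ j \<in> T" for a
    proof -
      have a1: "\<And>j. absval (a $ j) \<le> 1" using a repsD(1)[OF T(1)] by blast
      obtain d g where d: "\<And>j. absval (d j) \<le> 1" and g: "g \<in> poly_fun" and
        taylor: "\<And>y. h (\<chi> j. a $ j + \<pi> * y $ j) = h a + \<pi> * (\<Sum>j\<in>UNIV. d j * y $ j) + \<pi>\<^sup>2 * g y"
        using poly_fun_taylor[OF less.prems a1, of \<pi>] uniformizer_less by auto
      let ?Q = "\<lambda>y. absval (h (\<chi> j. a $ j + \<pi> * y $ j) - w) \<le> \<rho> ^ i"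
      show ?thesis
      proof (cases "\<exists>j. absval (d j) = 1")
        case True
        then obtain j where j: "absval (d j) = 1" by blast
        show ?thesis
        proof (cases "absval (w - h a) \<le> \<rho> ^ 1")
          case True
          then obtain v where v: "w - h a = \<pi> ^ 1 * v" "absval v \<le> 1"
            using exists_multiple_uniformizer_power by blast
          have "?Q y \<longleftrightarrow> absval ((\<Sum>j\<in>UNIV. d j * y $ j) + \<pi> * g y - v) \<le> \<rho> ^ Suc k" for y
          proof -
            have "h (\<chi> j. a $ j + \<pi> * y $ j) - w = \<pi> ^ 1 * ((\<Sum>j\<in>UNIV. d j * y $ j) + \<pi> * g y - v)"
              using v(1) unfolding taylor by (simp add: algebra_simps power2_eq_square)
            then show ?thesis
              using absval_uniformizer_power_mult_le_iff[of 1 _ "Suc k"] i by simp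
          qed
          then have "class_count (Suc k) ?Q = ?q ^ (Suc k * (?n - 1))"
            using class_count_hensel[of d j g v "Suc k"] d j g v(2) by simp
          moreover have "(?n * (i - 1) + 1) div 2 \<le> Suc k * (?n - 1)"
          proof -
            define m where "m = ?n - 2"
            have m: "?n = Suc (Suc m)" using n by (simp add: m_def)
            have "?n * (i - 1) \<le> 2 * (Suc k * (?n - 1))" unfolding m i by (simp add: algebra_simps)
            then show ?thesis by linarith
          qed
          ultimately show ?thesis by (simp add: le_imp_power_dvd)
        next
          case False
          have "\<not> ?Q y" if y: "\<And>j. absval (y $ j) \<le> 1" for y
          proof
            assume Q: "?Q y"
            have "absval (g y) \<le> 1" using poly_fun_integral[OF g y] .
            moreover have "absval (\<Sum>j\<in>UNIV. d j * y $ j) \<le> 1"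
              using poly_fun_integral[OF poly_fun_linear[OF d] y] .
            ultimately have "absval (\<pi> * ((\<Sum>j\<in>UNIV. d j * y $ j) + \<pi> * g y)) \<le> \<rho>"
              using uniformizer_less by (intro absval_mult_le absval_add_le) auto
            moreover have "\<rho> ^ i \<le> \<rho>"
              using rho_power_le_one[of "Suc k"] by (simp add: i mult_left_le del: power_Suc add: power_Suc[of _ "Suc k"])
            then have "absval (h (\<chi> j. a $ j + \<pi> * y $ j) - w) \<le> \<rho>" using Q by simp
            moreover have "w - h a = \<pi> * ((\<Sum>j\<in>UNIV. d j * y $ j) + \<pi> * g y) - (h (\<chi> j. a $ j + \<pi> * y $ j) - w)"
              unfolding taylor by (simp add: algebra_simps power2_eq_square)
            ultimately show False using False by (metis absval_diff_le power_one_right)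
          qed
          then have "class_count (Suc k) ?Q = class_count (Suc k) (\<lambda>_ :: 'k ^ 'n. False)"
            by (intro class_count_cong) auto
          then show ?thesis by (simp add: class_count_def)
        qed
      next
        case False
        \<comment> \<open>The whole gradient is divisible by \<open>\<pi>\<close>: the expansion has no term of order one in \<open>\<pi>\<close>.\<close>
        then have "absval (d j) \<le> \<rho> ^ 1" for j
          using d[of j] uniformizer_greatest[of "d j"] by (simp add: less_le)
        then have "\<exists>e. d j = \<pi> * e \<and> absval e \<le> 1" for j
          using exists_multiple_uniformizer_power[of "d j" 1] by (metis power_one_right)
        then obtain e where e: "\<And>j. d j = \<pi> * e j" "\<And>j. absval (e j) \<le> 1" by metis
        define g' where "g' y = (\<Sum>j\<in>UNIV. e j * y $ j) + g y" for y
        have g': "g' \<in> poly_fun"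
          unfolding g'_def using e(2) g by (intro poly_fun.add poly_fun_linear)
        have taylor': "h (\<chi> j. a $ j + \<pi> * y $ j) = h a + \<pi>\<^sup>2 * g' y" for y
          unfolding taylor g'_def e(1)
          by (simp add: sum_distrib_left mult.assoc distrib_left power2_eq_square)
        show ?thesis
        proof (cases "absval (w - h a) \<le> \<rho>\<^sup>2")
          case True
          then obtain v where v: "w - h a = \<pi>\<^sup>2 * v" "absval v \<le> 1"
            using exists_multiple_uniformizer_power by blast
          have "?Q y \<longleftrightarrow> absval (g' y - v) \<le> \<rho> ^ k" for y
          proof -
            have "h (\<chi> j. a $ j + \<pi> * y $ j) - w = \<pi>\<^sup>2 * (g' y - v)"
              using v(1) unfolding taylor' by (simp add: algebra_simps)
            then show ?thesis
              using absval_uniformizer_power_mult_le_iff[of 2 _ k] i by simp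
          qed
          then have "class_count (Suc k) ?Q = ?q ^ ?n * class_count k (\<lambda>y. absval (g' y - v) \<le> \<rho> ^ k)"
            using class_count_Suc_periodic[OF periodic_congruence[OF g', of k v]] by simp
          moreover have "?q ^ ?n * ?q ^ ((?n * (k - 1) + 1) div 2) dvd
              ?q ^ ?n * class_count k (\<lambda>y. absval (g' y - v) \<le> \<rho> ^ k)"
            using less.IH[OF _ g', of k v] i by (intro mult_dvd_mono) auto
          moreover have "(?n * (i - 1) + 1) div 2 \<le> ?n + (?n * (k - 1) + 1) div 2"
          proof -
            have "?n * (i - 1) \<le> 2 * ?n + ?n * (k - 1)" unfolding i by (cases k) auto
            then show ?thesis by linarith
          qed
          ultimately show ?thesis
            by (simp add: power_add[symmetric]) (meson dvd_trans le_imp_power_dvd)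
        next
          case False
          have "\<not> ?Q y" if y: "\<And>j. absval (y $ j) \<le> 1" for y
          proof
            assume Q: "?Q y"
            have "absval (\<pi>\<^sup>2 * g' y) \<le> \<rho>\<^sup>2"
              using poly_fun_integral[OF g' y] by (auto intro!: absval_mult_le simp: absval_power)
            moreover have "\<rho> ^ i \<le> \<rho>\<^sup>2"
              using rho_power_le_one[of k] by (simp add: i power2_eq_square mult_left_le mult.assoc[symmetric])
            then have "absval (h (\<chi> j. a $ j + \<pi> * y $ j) - w) \<le> \<rho>\<^sup>2" using Q by simp
            moreover have "w - h a = \<pi>\<^sup>2 * g' y - (h (\<chi> j. a $ j + \<pi> * y $ j) - w)"
              unfolding taylor' by simp
            ultimately show False using False by (metis absval_diff_le)
          qed
          then have "class_count (Suc k) ?Q = class_count (Suc k) (\<lambda>_ :: 'k ^ 'n. False)"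
            by (intro class_count_cong) auto
          then show ?thesis by (simp add: class_count_def)
        qed
      qed
    qed
    note dvd = this
    have split: "class_count i (\<lambda>x. absval (h x - w) \<le> \<rho> ^ i) = (\<Sum>a\<in>{a. \<forall>j. a $ j \<in> T}.
        class_count (Suc k) (\<lambda>y. absval (h (\<chi> j. a $ j + \<pi> ^ 1 * y $ j) - w) \<le> \<rho> ^ i))"
      using class_count_split[OF T, of "Suc k" "\<lambda>x. absval (h x - w) \<le> \<rho> ^ i"]
        periodic_congruence[OF less.prems, of i w] i by simp
    show ?thesis unfolding split by (rule dvd_sum) (use dvd in blast)
  qed
qed

lemma num_solutions_eq_class_count:
  "num_solutions i f (coset (max_ideal_power i) w) = class_count i (\<lambda>x. absval (f x - w) \<le> \<rho> ^ i)"
  unfolding num_solutions_def class_count_def coset_max_ideal_power_eq_iff ..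

end

theorem mainTheorem1:
  fixes f :: "'k::nonarch_valued_field ^ 'n::finite \<Rightarrow> 'k" and p i :: nat and u :: "'k set"
  assumes "padic_field p TYPE('k)"
    and "CARD('n) > 1"
    and "rigid_analytic_over_R f"
    and "i > 0"
    and "u \<in> quotient_ring (max_ideal_power i)"
  shows "residue_card TYPE('k) ^ nat \<lceil>real CARD('n) / 2 * (real i - 1)\<rceil> dvd num_solutions i f u"
proof -
  obtain \<pi> :: 'k where "uniformizer \<pi>" using padic_field_uniformizer[OF assms(1)] by blast
  then interpret uniformizer \<pi> .
  obtain w where u: "u = coset (max_ideal_power i) w"
    using assms(5) by (auto simp: quotient_ring_def)
  obtain h where h: "h \<in> poly_fun" "\<And>x. (\<And>j. absval (x $ j) \<le> 1) \<Longrightarrow> absval (f x - h x) \<le> \<rho> ^ i"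
    using rigid_analytic_approx_poly_fun[OF assms(3), of "\<rho> ^ i"] by auto
  have "class_count i (\<lambda>x. absval (f x - w) \<le> \<rho> ^ i) = class_count i (\<lambda>x. absval (h x - w) \<le> \<rho> ^ i)"
  proof (rule class_count_cong)
    fix x :: "'k ^ 'n" assume "\<And>j. absval (x $ j) \<le> 1"
    then have "absval (f x - h x) \<le> \<rho> ^ i" "absval (h x - f x) \<le> \<rho> ^ i"
      using h(2) by (simp_all add: absval_minus_commute[of "h x"])
    then show "absval (f x - w) \<le> \<rho> ^ i \<longleftrightarrow> absval (h x - w) \<le> \<rho> ^ i"
      using absval_trans_le by blast
  qed
  moreover have "nat \<lceil>real CARD('n) / 2 * (real i - 1)\<rceil> = (CARD('n) * (i - 1) + 1) div 2"
  proof -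
    have "real CARD('n) / 2 * (real i - 1) = real (CARD('n) * (i - 1)) / 2"
      using assms(4) by (simp add: of_nat_diff)
    moreover have "nat \<lceil>real m / 2\<rceil> = (m + 1) div 2" for m by linarith
    ultimately show ?thesis by metis
  qed
  ultimately show ?thesis
    unfolding u num_solutions_eq_class_count
    using residue_card_power_dvd_class_count[OF assms(2) h(1), of i w] by metis
qed

end
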